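(* As algebras over the operad $\mathcal{SP}$, the algebra of shuffle series $\{\mathcal{SH}(P)\}$ ($P$ ranging over $SP$-posets) is isomorphic to the algebra of weak order series $\{\mathfrak{Z}^+(P)\}$. Moreover, for every $SP$-poset $P$ with $n=|P|$, if $$\mathfrak{Z}^+(P)=\sum_{i=1}^{n}(-1)^{n-i}d_{P,i}\,\mathfrak{Z}^+(i),$$ then $$\mathcal{SH}(P)=\sum_{i=1}^{n}(-1)^{n-i}d_{P,i}\,\mathcal{SH}(i).$$
   Context: Posets are finite and considered up to isomorphism. $\langle n\rangle$ is the chain $1<2<\cdots<n$ ($\langle 0\rangle$ is empty). $P\sqcup Q$ is the disjoint union of posets; $P\oplus Q$ is the ordinal sum (every element of $P$ below every element of $Q$). An $SP$-poset is a poset obtained from one-point posets by finitely many applications of $\sqcup$ and $\oplus$. Weak order series. $\mathfrak{Z}^+(P)=\sum_{n\ge 1}\Omega(P,n)x^n$, where $\Omega(P,n)$ is the number of weakly order-preserving maps $P\to\langle n\rangle$ ($x\le y\Rightarrow f(x)\le f(y)$); $\mathfrak{Z}^+(i):=\mathfrak{Z}^+(\langle i\rangle)=\frac{x}{(1-x)^{i+1}}$. The integers $d_{P,i}$ are defined by $\Omega^\circ(P,x)=\sum_{i=1}^{|P|}d_{P,i}\binom{x}{i}$, where $\Omega^\circ(P,n)$ is the number of strict order-preserving maps $P\to \langle n\rangle$ ($x<y\Rightarrow f(x)<f(y)$). Shuffle series. A (colimit-indexing) shuffle of an $SP$-poset $P$ and $\langle n\rangle$ is a finite poset $A$ such that: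 every point of $A$ is labeled by a point of $P$ or a point of $\langle n\rangle$; $A$ has the same number of minimal points as $P$ and the same number of maximal points as $P$; and there is a bijection $M\mapsto A_M$ from maximal chains of $P$ to maximal chains of $A$ such that the labels along $A_M$ list every element of $M$ and every element of $\langle n\rangle$ exactly once, preserving the order of $M$ and of $\langle n\rangle$. Every point of $P$ labels exactly one point of $A$ (a point of $\langle n\rangle$ may label several), and two shuffles are identified if for every $M$ the label sequences along the corresponding chains coincide. $\mathcal{SH}(P)=\sum_{n\ge 0}\#\hom_{Shuffle}(P,\langle n\rangle)x^n$, where $\hom_{Shuffle}(P,\langle n\rangle)$ is the set of these shuffles (one shuffle if $n=0$), and $\mathcal{SH}(i):=\mathcal{SH}(\langle i\rangle)$. An algebra over $\mathcal{SP}$ here is a set with an action of the operations generated by the two binary operations $\sqcup$ and $\oplus$. On shuffle series, $\sqcup$ acts by the Hadamard (coefficientwise) product and $\oplus$ by $(f,g)\mapsto f(1-x)g$. On weak order series, $\sqcup$ acts by the Hadamard product and $\oplus$ by $(f,g)\mapsto f\frac{1-x}{x}g$. In each case the action satisfies that the operation $\sqcup$ (resp. $\oplus$) applied to the series of $P$ and $Q$ is the series of $P\sqcup Q$ (resp. $P\oplus Q$). An isomorphism of such algebras is a bijection commuting with both operations. *)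

theory Defs
  imports
    "HOL-Computational_Algebra.Formal_Power_Series"
    "HOL-Library.FuncSet"
    "HOL-Library.Infinite_Set"
begin

section \<open>Finite posets\<close>

text \<open>A poset is given by its reflexive order relation \<open>P\<close>; its underlying set is \<open>Field P\<close>.\<close>

definition finite_poset :: "'a rel \<Rightarrow> bool" where
  "finite_poset P \<longleftrightarrow> finite P \<and> Partial_order P"

text \<open>The chain \<open>1 < 2 < \<dots> < n\<close>.\<close>

definition chain_poset :: "nat \<Rightarrow> nat rel" where
  "chain_poset n = {(i, j). 1 \<le> i \<and> i \<le> j \<and> j \<le> n}"

text \<open>The two sums are only used for posets with disjoint underlying sets.\<close>

definition disjoint_sum :: "'a rel \<Rightarrow> 'a rel \<Rightarrow> 'a rel" where
  "disjoint_sum P Q = P \<union> Q"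

definition ordinal_sum :: "'a rel \<Rightarrow> 'a rel \<Rightarrow> 'a rel" where
  "ordinal_sum P Q = P \<union> Q \<union> Field P \<times> Field Q"

text \<open>
  As the one-point posets and the summands may have arbitrary points, this class is closed under
  isomorphism. On an infinite type such as \<open>nat\<close> it contains every \<open>SP\<close>-poset up to isomorphism.
\<close>

inductive sp_poset :: "'a rel \<Rightarrow> bool" where
  point: "sp_poset {(a, a)}"
| disjoint_sum: "sp_poset P \<Longrightarrow> sp_poset Q \<Longrightarrow> Field P \<inter> Field Q = {} \<Longrightarrow> sp_poset (disjoint_sum P Q)"
| ordinal_sum: "sp_poset P \<Longrightarrow> sp_poset Q \<Longrightarrow> Field P \<inter> Field Q = {} \<Longrightarrow> sp_poset (ordinal_sum P Q)"

definition minimal_points :: "'a rel \<Rightarrow> 'a set" where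
  "minimal_points P = {x \<in> Field P. \<forall>y. (y, x) \<in> P \<longrightarrow> y = x}"

definition maximal_points :: "'a rel \<Rightarrow> 'a set" where
  "maximal_points P = {x \<in> Field P. \<forall>y. (x, y) \<in> P \<longrightarrow> y = x}"

definition maximal_chains :: "'a rel \<Rightarrow> 'a set set" where
  "maximal_chains P = {C. pred_on.maxchain (Field P) (\<lambda>x y. (x, y) \<in> P) C}"

text \<open>The elements of a finite chain \<open>C\<close> of \<open>P\<close>, listed in increasing order.\<close>

definition chain_list :: "'a rel \<Rightarrow> 'a set \<Rightarrow> 'a list" where
  "chain_list P C = (THE xs. distinct xs \<and> set xs = C \<and> sorted_wrt (\<lambda>x y. (x, y) \<in> P) xs)"


section \<open>Order-preserving maps and the weak order series\<close>

definition weak_maps :: "'a rel \<Rightarrow> nat \<Rightarrow> ('a \<Rightarrow> nat) set" where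
  "weak_maps P n = {f \<in> Field P \<rightarrow>\<^sub>E {1..n}. \<forall>x y. (x, y) \<in> P \<longrightarrow> f x \<le> f y}"

definition strict_maps :: "'a rel \<Rightarrow> nat \<Rightarrow> ('a \<Rightarrow> nat) set" where
  "strict_maps P n = {f \<in> Field P \<rightarrow>\<^sub>E {1..n}. \<forall>x y. (x, y) \<in> P \<and> x \<noteq> y \<longrightarrow> f x < f y}"

definition weak_order_series :: "'a rel \<Rightarrow> rat fps" where
  "weak_order_series P = Abs_fps (\<lambda>n. if n \<ge> 1 then of_nat (card (weak_maps P n)) else 0)"

text \<open>
  The integers \<open>d\<^sub>i\<close> with \<open>1 \<le> i \<le> |P|\<close> in the binomial expansion of the strict order polynomial
  of \<open>P\<close>, extended by \<open>0\<close> to all other \<open>i\<close>. A polynomial identity is the same as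
  an identity at all natural numbers. Lemma \<open>strict_coeff_ex1\<close> below shows
  that the description is proper.
\<close>

definition strict_coeff :: "'a rel \<Rightarrow> nat \<Rightarrow> int" where
  "strict_coeff P = (THE d. (\<forall>i. i \<notin> {1..card (Field P)} \<longrightarrow> d i = 0) \<and>
     (\<forall>n. int (card (strict_maps P n)) = (\<Sum>i = 1..card (Field P). d i * int (n choose i))))"


section \<open>Shuffles\<close>

text \<open>
  A candidate for a shuffle of \<open>P\<close> with the chain of length \<open>n\<close> is a triple \<open>(A, l, \<Phi>)\<close>
  of a poset (finite, so without loss of generality on natural numbers), a labelling of its points by
  points of \<open>P\<close> (\<open>Inl\<close>) or of the chain (\<open>Inr\<close>), and the assignment of a maximal chain of \<open>A\<close>
  to every maximal chain of \<open>P\<close>.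
\<close>

type_synonym 'a shuffle_data = "nat rel \<times> (nat \<Rightarrow> 'a + nat) \<times> ('a set \<Rightarrow> nat set)"

definition label_sequence :: "'a shuffle_data \<Rightarrow> 'a set \<Rightarrow> ('a + nat) list" where
  "label_sequence = (\<lambda>(A, l, \<Phi>) M. map l (chain_list A (\<Phi> M)))"

text \<open>
  The labels along the chain of \<open>M\<close> form an interleaving of the list of \<open>M\<close> and the list
  \<open>[1, \<dots>, n]\<close>; this is what \<^const>\<open>shuffles\<close> (of lists) expresses.
\<close>

definition is_shuffle :: "'a rel \<Rightarrow> nat \<Rightarrow> 'a shuffle_data \<Rightarrow> bool" where
  "is_shuffle P n = (\<lambda>(A, l, \<Phi>).
     finite_poset A \<and>
     l ` Field A \<subseteq> Field P <+> {1..n} \<and>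
     (\<forall>p \<in> Field P. \<exists>!a. a \<in> Field A \<and> l a = Inl p) \<and>
     card (minimal_points A) = card (minimal_points P) \<and>
     card (maximal_points A) = card (maximal_points P) \<and>
     bij_betw \<Phi> (maximal_chains P) (maximal_chains A) \<and>
     (\<forall>M \<in> maximal_chains P. label_sequence (A, l, \<Phi>) M \<in>
        shuffles (map Inl (chain_list P M)) (map Inr (chain_list (chain_poset n) {1..n}))))"

definition shuffle_equiv :: "'a rel \<Rightarrow> nat \<Rightarrow> 'a shuffle_data rel" where
  "shuffle_equiv P n = {(s, t). is_shuffle P n s \<and> is_shuffle P n t \<and>
     (\<forall>M \<in> maximal_chains P. label_sequence s M = label_sequence t M)}"

definition hom_Shuffle :: "'a rel \<Rightarrow> nat \<Rightarrow> 'a shuffle_data set set" where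
  "hom_Shuffle P n = {s. is_shuffle P n s} // shuffle_equiv P n"

definition shuffle_series :: "'a rel \<Rightarrow> rat fps" where
  "shuffle_series P = Abs_fps (\<lambda>n. of_nat (card (hom_Shuffle P n)))"


section \<open>Algebras over the operad of series-parallel posets\<close>

text \<open>
  An action of all operations generated by \<open>\<squnion>\<close> and \<open>\<oplus>\<close>, that is, of all \<open>SP\<close>-posets with
  labelled points: the operations have to satisfy the identities that hold for sums of posets up to
  isomorphism.
\<close>

locale sp_algebra =
  fixes S :: "'s set"
    and du :: "'s \<Rightarrow> 's \<Rightarrow> 's"
    and os :: "'s \<Rightarrow> 's \<Rightarrow> 's"
  assumes du_closed: "x \<in> S \<Longrightarrow> y \<in> S \<Longrightarrow> du x y \<in> S"
    and os_closed: "x \<in> S \<Longrightarrow> y \<in> S \<Longrightarrow> os x y \<in> S"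
    and du_commute: "x \<in> S \<Longrightarrow> y \<in> S \<Longrightarrow> du x y = du y x"
    and du_assoc: "x \<in> S \<Longrightarrow> y \<in> S \<Longrightarrow> z \<in> S \<Longrightarrow> du (du x y) z = du x (du y z)"
    and os_assoc: "x \<in> S \<Longrightarrow> y \<in> S \<Longrightarrow> z \<in> S \<Longrightarrow> os (os x y) z = os x (os y z)"

definition sp_algebra_iso ::
    "'s set \<Rightarrow> ('s \<Rightarrow> 's \<Rightarrow> 's) \<Rightarrow> ('s \<Rightarrow> 's \<Rightarrow> 's) \<Rightarrow>
     't set \<Rightarrow> ('t \<Rightarrow> 't \<Rightarrow> 't) \<Rightarrow> ('t \<Rightarrow> 't \<Rightarrow> 't) \<Rightarrow> ('s \<Rightarrow> 't) \<Rightarrow> bool" where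
  "sp_algebra_iso S du os T du' os' \<phi> \<longleftrightarrow>
     sp_algebra S du os \<and> sp_algebra T du' os' \<and> bij_betw \<phi> S T \<and>
     (\<forall>x \<in> S. \<forall>y \<in> S. \<phi> (du x y) = du' (\<phi> x) (\<phi> y)) \<and>
     (\<forall>x \<in> S. \<forall>y \<in> S. \<phi> (os x y) = os' (\<phi> x) (\<phi> y))"

definition hadamard :: "'r::times fps \<Rightarrow> 'r fps \<Rightarrow> 'r fps" where
  "hadamard f g = Abs_fps (\<lambda>n. fps_nth f n * fps_nth g n)"

definition shuffle_series_set :: "rat fps set" where
  "shuffle_series_set = {shuffle_series P |P :: nat rel. sp_poset P}"

definition shuffle_oplus :: "rat fps \<Rightarrow> rat fps \<Rightarrow> rat fps" where
  "shuffle_oplus f g = f * (1 - fps_X) * g"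

definition weak_order_series_set :: "rat fps set" where
  "weak_order_series_set = {weak_order_series P |P :: nat rel. sp_poset P}"

text \<open>
  \<open>(1 - x) / x\<close> is not a power series, so the division by \<open>x\<close> has to come last; it is exact on
  weak order series, whose constant coefficients vanish.
\<close>

definition weak_order_oplus :: "rat fps \<Rightarrow> rat fps \<Rightarrow> rat fps" where
  "weak_order_oplus f g = (f * (1 - fps_X) * g) / fps_X"


section \<open>The descriptions used above are proper\<close>

lemma sp_poset_finite_poset: "sp_poset P \<Longrightarrow> finite_poset P \<and> Field P \<noteq> {}"
proof (induction rule: sp_poset.induct)
  case (point a)
  then show ?case
    by (auto simp: finite_poset_def partial_order_on_def preorder_on_def refl_on_def trans_def
        antisym_def Field_def)
next
  case (disjoint_sum P Q)
  have F: "Field (disjoint_sum P Q) = Field P \<union> Field Q"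
    using disjoint_sum by (auto simp: disjoint_sum_def Field_def)
  have tr: "trans P" "trans Q" and an: "antisym P" "antisym Q"
    and fin: "finite P" "finite Q" and re: "refl_on (Field P) P" "refl_on (Field Q) Q"
    using disjoint_sum by (auto simp: finite_poset_def partial_order_on_def preorder_on_def)
  have d: "\<And>x. x \<in> Field P \<Longrightarrow> x \<notin> Field Q" using disjoint_sum by auto
  have fi: "\<And>x y. (x, y) \<in> P \<Longrightarrow> x \<in> Field P \<and> y \<in> Field P"
    "\<And>x y. (x, y) \<in> Q \<Longrightarrow> x \<in> Field Q \<and> y \<in> Field Q" by (auto simp: Field_def)
  have "trans (disjoint_sum P Q)"
    unfolding disjoint_sum_def trans_def using d fi tr[unfolded trans_def] by blast
  moreover have "antisym (disjoint_sum P Q)"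
    unfolding disjoint_sum_def antisym_def using d fi an[unfolded antisym_def] by blast
  moreover have "refl_on (Field (disjoint_sum P Q)) (disjoint_sum P Q)"
    unfolding F using re by (auto simp: refl_on_def disjoint_sum_def)
  moreover have "finite (disjoint_sum P Q)"
    unfolding disjoint_sum_def using fin by (auto intro: finite_Field)
  moreover have "disjoint_sum P Q \<subseteq> Field (disjoint_sum P Q) \<times> Field (disjoint_sum P Q)"
    by (auto simp: Field_def)
  ultimately show ?case
    using disjoint_sum F by (auto simp: finite_poset_def partial_order_on_def preorder_on_def)
next
  case (ordinal_sum P Q)
  have F: "Field (ordinal_sum P Q) = Field P \<union> Field Q"
    using ordinal_sum by (auto simp: ordinal_sum_def Field_def)
  have tr: "trans P" "trans Q" and an: "antisym P" "antisym Q"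
    and fin: "finite P" "finite Q" and re: "refl_on (Field P) P" "refl_on (Field Q) Q"
    using ordinal_sum by (auto simp: finite_poset_def partial_order_on_def preorder_on_def)
  have d: "\<And>x. x \<in> Field P \<Longrightarrow> x \<notin> Field Q" using ordinal_sum by auto
  have fi: "\<And>x y. (x, y) \<in> P \<Longrightarrow> x \<in> Field P \<and> y \<in> Field P"
    "\<And>x y. (x, y) \<in> Q \<Longrightarrow> x \<in> Field Q \<and> y \<in> Field Q" by (auto simp: Field_def)
  have "trans (ordinal_sum P Q)"
    unfolding ordinal_sum_def trans_def using d fi tr[unfolded trans_def] by blast
  moreover have "antisym (ordinal_sum P Q)"
    unfolding ordinal_sum_def antisym_def using d fi an[unfolded antisym_def] by blast
  moreover have "refl_on (Field (ordinal_sum P Q)) (ordinal_sum P Q)"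
    unfolding F using re by (auto simp: refl_on_def ordinal_sum_def)
  moreover have "finite (ordinal_sum P Q)"
    unfolding ordinal_sum_def using fin by (auto intro: finite_Field)
  moreover have "ordinal_sum P Q \<subseteq> Field (ordinal_sum P Q) \<times> Field (ordinal_sum P Q)"
    by (auto simp: Field_def)
  ultimately show ?case
    using ordinal_sum F by (auto simp: finite_poset_def partial_order_on_def preorder_on_def)
qed

lemma chain_list_ex1:
  assumes "finite_poset P" "C \<in> maximal_chains P"
  shows "\<exists>!xs. distinct xs \<and> set xs = C \<and> sorted_wrt (\<lambda>x y. (x, y) \<in> P) xs"
proof -
  have "pred_on.chain (Field P) (\<lambda>x y. (x, y) \<in> P) C"
    using assms(2) by (simp add: maximal_chains_def pred_on.maxchain_def)
  then have sub: "C \<subseteq> Field P"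
    and lin: "\<And>x y. x \<in> C \<Longrightarrow> y \<in> C \<Longrightarrow> (x, y) \<in> P \<or> x = y \<or> (y, x) \<in> P"
    unfolding pred_on.chain_def by auto
  have fin: "finite C" using sub assms(1) finite_subset
    by (metis finite_Field finite_poset_def)
  have an: "antisym P" and tr: "trans P"
    using assms(1) by (auto simp: finite_poset_def partial_order_on_def preorder_on_def)
  have ex: "\<exists>xs. distinct xs \<and> set xs = D \<and> sorted_wrt (\<lambda>x y. (x, y) \<in> P) xs"
    if "D \<subseteq> C" for D
    using finite_subset[OF that fin] that
  proof (induction D rule: finite_psubset_induct)
    case (psubset D)
    show ?case
    proof (cases "D = {}")
      case False
      have "\<exists>m \<in> D. \<forall>y \<in> D. (m, y) \<in> P \<or> m = y"
        using psubset.hyps False psubset.prems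
      proof (induction D rule: finite_ne_induct)
        case (insert x F)
        then obtain m where "m \<in> F" "\<forall>y \<in> F. (m, y) \<in> P \<or> m = y" by auto
        then show ?case using lin[of x m] insert.prems tr[unfolded trans_def] by blast
      qed auto
      then obtain m where m: "m \<in> D" "\<forall>y \<in> D. (m, y) \<in> P \<or> m = y" by auto
      obtain xs where "distinct xs" "set xs = D - {m}" "sorted_wrt (\<lambda>x y. (x, y) \<in> P) xs"
        using psubset.IH[of "D - {m}"] m psubset.prems by auto
      then have "distinct (m # xs) \<and> set (m # xs) = D \<and> sorted_wrt (\<lambda>x y. (x, y) \<in> P) (m # xs)"
        using m by auto
      then show ?thesis by blast
    qed auto
  qed
  have uniq: "xs = ys"
    if "distinct xs" "distinct ys" "set xs = set ys" "sorted_wrt (\<lambda>x y. (x, y) \<in> P) xs"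
      "sorted_wrt (\<lambda>x y. (x, y) \<in> P) ys" for xs ys
    using that
  proof (induction xs arbitrary: ys)
    case (Cons x xs)
    then obtain y zs where ys: "ys = y # zs" by (cases ys) auto
    have "x = y"
    proof (rule ccontr)
      assume "x \<noteq> y"
      then have "y \<in> set xs" "x \<in> set zs"
        using Cons.prems(3) unfolding ys by (metis list.set_intros(1) set_ConsD)+
      then have "(x, y) \<in> P" "(y, x) \<in> P" using Cons.prems(4,5) unfolding ys by simp_all
      then show False using an \<open>x \<noteq> y\<close> by (blast dest: antisymD)
    qed
    moreover have "set xs = set zs"
      using Cons.prems(1-3) calculation unfolding ys by (simp add: insert_ident)
    ultimately show ?case using Cons.prems Cons.IH[of zs] unfolding ys by simp
  qed simp
  show ?thesis using ex[OF subset_refl] uniq by blast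
qed

lemma strict_coeff_ex1:
  assumes "finite P" "P \<noteq> {}"
  shows "\<exists>!d. (\<forall>i. i \<notin> {1..card (Field P)} \<longrightarrow> d i = 0) \<and>
    (\<forall>n. int (card (strict_maps P n)) = (\<Sum>i = 1..card (Field P). d i * int (n choose i)))"
proof -
  define F where "F = Field P"
  define N where "N = card F"
  define onto where "onto = (\<lambda>S :: nat set. {f \<in> F \<rightarrow>\<^sub>E S. f ` F = S \<and>
    (\<forall>x y. (x, y) \<in> P \<and> x \<noteq> y \<longrightarrow> f x < f y)})"
  define c where "c = (\<lambda>k. card (onto {..<k}))"
  have fin: "finite F" and ne: "F \<noteq> {}"
    using assms by (simp_all add: F_def finite_Field) (auto simp: Field_def)
  have inF: "\<And>x y. (x, y) \<in> P \<Longrightarrow> x \<in> F \<and> y \<in> F" by (auto simp: F_def Field_def)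
  have card_onto: "card (onto S) = c (card S)" if finS: "finite S" for S
  proof -
    obtain h where h: "bij_betw h {..<card S} S" "strict_mono_on {..<card S} h"
      by (rule ex_bij_betw_strict_mono_card[OF finS])
    have lt: "h a < h b \<longleftrightarrow> a < b" if "a < card S" "b < card S" for a b
      using strict_mono_on_less[OF h(2)] that by simp
    have inj: "inj_on h {..<card S}" and im: "h ` {..<card S} = S"
      using h(1) by (auto simp: bij_betw_def)
    have "bij_betw (\<lambda>f. restrict (h \<circ> f) F) (onto {..<card S}) (onto S)"
    proof (rule bij_betwI[where g = "\<lambda>f. restrict (inv_into {..<card S} h \<circ> f) F"])
      show "(\<lambda>f. restrict (h \<circ> f) F) \<in> onto {..<card S} \<rightarrow> onto S"
      proof
        fix f assume f: "f \<in> onto {..<card S}"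
        then have fi: "\<And>x. x \<in> F \<Longrightarrow> f x < card S" and fF: "f ` F = {..<card S}"
          and fs: "\<And>x y. (x, y) \<in> P \<Longrightarrow> x \<noteq> y \<Longrightarrow> f x < f y"
          by (auto simp: onto_def)
        have "restrict (h \<circ> f) F ` F = S" using fF im by (metis image_comp image_restrict_eq)
        moreover have "restrict (h \<circ> f) F x < restrict (h \<circ> f) F y" if "(x, y) \<in> P" "x \<noteq> y" for x y
          using that inF[OF that(1)] fi lt fs by auto
        ultimately show "restrict (h \<circ> f) F \<in> onto S" unfolding onto_def by auto
      qed
    next
      show "(\<lambda>f. restrict (inv_into {..<card S} h \<circ> f) F) \<in> onto S \<rightarrow> onto {..<card S}"
      proof
        fix f assume f: "f \<in> onto S"
        let ?g = "inv_into {..<card S} h"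
        from f have fi: "\<And>x. x \<in> F \<Longrightarrow> f x \<in> S" and fF: "f ` F = S"
          and fs: "\<And>x y. (x, y) \<in> P \<Longrightarrow> x \<noteq> y \<Longrightarrow> f x < f y"
          by (auto simp: onto_def)
        have g: "?g s < card S" "h (?g s) = s" if "s \<in> S" for s
          using that im inv_into_into[of s h "{..<card S}"] f_inv_into_f[of s h "{..<card S}"] by auto
        have "?g ` S = {..<card S}" using inj im by (metis inv_into_image_cancel subset_refl)
        then have "restrict (?g \<circ> f) F ` F = {..<card S}" using fF by (metis image_comp image_restrict_eq)
        moreover have "restrict (?g \<circ> f) F x < restrict (?g \<circ> f) F y" if "(x, y) \<in> P" "x \<noteq> y" for x y
          using that inF[OF that(1)] fi fs lt[of "?g (f x)" "?g (f y)"] g by auto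
        ultimately show "restrict (?g \<circ> f) F \<in> onto {..<card S}" unfolding onto_def by auto
      qed
    next
      fix f assume "f \<in> onto {..<card S}"
      then have "f \<in> F \<rightarrow>\<^sub>E {..<card S}" by (auto simp: onto_def)
      then show "restrict (inv_into {..<card S} h \<circ> restrict (h \<circ> f) F) F = f"
        using inj by (auto simp: fun_eq_iff restrict_def PiE_def Pi_def extensional_def inv_into_f_f)
    next
      fix f assume "f \<in> onto S"
      then have "f \<in> F \<rightarrow>\<^sub>E S" by (auto simp: onto_def)
      then show "restrict (h \<circ> restrict (inv_into {..<card S} h \<circ> f) F) F = f"
        using im by (auto simp: fun_eq_iff restrict_def PiE_def Pi_def extensional_def f_inv_into_f)
    qed
    then show ?thesis unfolding c_def by (metis bij_betw_same_card)
  qed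
  have c0: "c k = 0" if "k \<notin> {1..N}" for k
  proof -
    have "onto {..<k} = {}"
    proof (rule ccontr)
      assume "onto {..<k} \<noteq> {}"
      then obtain f where "f ` F = {..<k}" by (auto simp: onto_def)
      then have "k \<le> N" "k \<noteq> 0"
        using card_image_le[OF fin, of f] ne by (auto simp: N_def)
      then show False using that by simp
    qed
    then show ?thesis by (simp add: c_def)
  qed
  have cnt: "card (strict_maps P n) = (\<Sum>i = 1..N. c i * (n choose i))" for n
  proof -
    have "strict_maps P n = (\<Union>S \<in> Pow {1..n}. onto S)"
      by (auto simp: strict_maps_def onto_def F_def PiE_def Pi_def image_subset_iff)
    moreover have "finite (onto S)" if "finite S" for S
      unfolding onto_def by (rule finite_subset[OF _ finite_PiE[of F "\<lambda>_. S"]]) (use fin that in auto)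
    ultimately have "card (strict_maps P n) = (\<Sum>S \<in> Pow {1..n}. card (onto S))"
      by (simp only:, subst card_UN_disjoint) (auto simp: onto_def finite_subset)
    also have "\<dots> = (\<Sum>S \<in> Pow {1..n}. c (card S))"
      by (intro sum.cong refl card_onto) (auto intro: finite_subset)
    also have "\<dots> = (\<Sum>k \<in> {..n}. \<Sum>S \<in> {S \<in> Pow {1..n}. card S = k}. c (card S))"
      by (rule sum.group[symmetric]) (auto dest: card_mono[rotated])
    also have "\<dots> = (\<Sum>k \<in> {..n}. c k * (n choose k))"
    proof (intro sum.cong refl)
      fix k
      have "card {S \<in> Pow {1..n}. card S = k} = n choose k"
        using n_subsets[of "{1..n}" k] by simp
      then show "(\<Sum>S \<in> {S \<in> Pow {1..n}. card S = k}. c (card S)) = c k * (n choose k)"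
        by simp
    qed
    also have "\<dots> = (\<Sum>k \<in> {..max n N}. c k * (n choose k))"
      by (rule sum.mono_neutral_left) auto
    also have "\<dots> = (\<Sum>k = 1..N. c k * (n choose k))"
      by (rule sum.mono_neutral_right) (use c0 in auto)
    finally show ?thesis .
  qed
  show ?thesis
    unfolding F_def[symmetric] N_def[symmetric]
  proof (rule ex_ex1I)
    show "\<exists>d. (\<forall>i. i \<notin> {1..N} \<longrightarrow> d i = 0) \<and>
        (\<forall>n. int (card (strict_maps P n)) = (\<Sum>i = 1..N. d i * int (n choose i)))"
      by (rule exI[of _ "\<lambda>i. int (c i)"]) (use c0 in \<open>auto simp: cnt\<close>)
  next
    fix d e :: "nat \<Rightarrow> int"
    assume d: "(\<forall>i. i \<notin> {1..N} \<longrightarrow> d i = 0) \<and>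
        (\<forall>n. int (card (strict_maps P n)) = (\<Sum>i = 1..N. d i * int (n choose i)))"
      and e: "(\<forall>i. i \<notin> {1..N} \<longrightarrow> e i = 0) \<and>
        (\<forall>n. int (card (strict_maps P n)) = (\<Sum>i = 1..N. e i * int (n choose i)))"
    have "d i = e i" for i
    proof (induction i rule: less_induct)
      case (less i)
      show ?case
      proof (cases "i \<in> {1..N}")
        case True
        have split: "(\<Sum>j = 1..N. a j * int (i choose j)) =
            (\<Sum>j \<in> {1..N} - {i}. a j * int (i choose j)) + a i" for a :: "nat \<Rightarrow> int"
          using True by (simp add: sum.remove[of _ i])
        have "(\<Sum>j \<in> {1..N} - {i}. d j * int (i choose j)) =
            (\<Sum>j \<in> {1..N} - {i}. e j * int (i choose j))"
        proof (rule sum.cong)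
          fix j assume "j \<in> {1..N} - {i}"
          then show "d j * int (i choose j) = e j * int (i choose j)"
            using less.IH[of j] by (cases "j < i") auto
        qed simp
        moreover have "(\<Sum>j = 1..N. d j * int (i choose j)) = (\<Sum>j = 1..N. e j * int (i choose j))"
          using d e by metis
        ultimately show ?thesis using split[of d] split[of e] by simp
      qed (use d e in auto)
    qed
    then show "d = e" by auto
  qed
qed

end

(*
  Let p be a point of P and cut two maximal chains of a shuffle A through the point labelled p. The lower
  half of one together with the upper half of the other is again a maximal chain of A, so it carries every
  letter of the chain of length n exactly once. Hence the number of letters below p does not depend on the
  chain, and a shuffle is the same thing as a weakly order-preserving map of P to {0, ..., n}; conversely such
  a map f is realized by subdividing each edge p < q of the Hasse diagram by the f q - f p letters in between.
  So the n-th coefficient of SH(P) is the (n+1)-st coefficient of the weak order series, i.e. the weak order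
  series is x SH(P) for every finite nonempty poset P. Multiplication by x is the isomorphism, and it carries the
  linear relation between weak order series to the one between shuffle series.
*)

theory Submission
  imports Defs
begin

section \<open>Maximal chains of finite posets\<close>

text \<open>A shuffle is an equivalence class of arbitrary posets, but the class is determined by
  its label sequences, and each of these has the form \<open>weave f\<close> for one map
  \<open>f\<close> common to all chains. So the classes are counted through families of label
  sequences, and no classification of the posets \<open>A\<close> themselves is attempted.

  The delicate direction is to realize a given map. Letters on different edges need different points
  even if they are equal as letters: if two edges shared a point, a chain could change edges there,
  and \<open>A\<close> would have too many maximal chains. The letters below a minimal or above a
  maximal point of \<open>P\<close> lie on no edge of \<open>P\<close>; each such point gets an edge
  of its own, since a common bottom or top would change the number of minimal or maximal points.

  For the algebra structure, the series of a sum is computed from order-preserving maps: the factor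
  \<open>1 - x\<close> is a finite difference, which selects the maps with a prescribed largest
  value on the lower summand.\<close>

lemma finite_posetD:
  assumes "finite_poset P"
  shows "finite (Field P)" "finite P" "antisym P" "trans P" "\<And>x. x \<in> Field P \<Longrightarrow> (x, x) \<in> P"
  using assms
  by (auto simp: finite_poset_def partial_order_on_def preorder_on_def refl_on_def finite_Field)

text \<open>Reflexivity makes comparability include equality, and a chain is maximal as soon as no
  single element can be added to it.\<close>

lemma maximal_chains_iff:
  assumes "finite_poset P"
  shows "C \<in> maximal_chains P \<longleftrightarrow> C \<subseteq> Field P \<and> (\<forall>x\<in>C. \<forall>y\<in>C. (x, y) \<in> P \<or> (y, x) \<in> P) \<and>
    (\<forall>z\<in>Field P. (\<forall>x\<in>C. (x, z) \<in> P \<or> (z, x) \<in> P) \<longrightarrow> z \<in> C)" (is "?L \<longleftrightarrow> ?R")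
proof -
  note re = finite_posetD(5)[OF assms]
  have ch: "pred_on.chain (Field P) (\<lambda>x y. (x, y) \<in> P) D \<longleftrightarrow>
      D \<subseteq> Field P \<and> (\<forall>x\<in>D. \<forall>y\<in>D. (x, y) \<in> P \<or> (y, x) \<in> P)" for D
    using re unfolding pred_on.chain_def by blast
  show ?thesis
  proof
    assume L: ?L
    then have C: "C \<subseteq> Field P" "\<forall>x\<in>C. \<forall>y\<in>C. (x, y) \<in> P \<or> (y, x) \<in> P"
      by (auto simp: maximal_chains_def pred_on.maxchain_def ch)
    have "z \<in> C" if "z \<in> Field P" "\<forall>x\<in>C. (x, z) \<in> P \<or> (z, x) \<in> P" for z
    proof (rule ccontr)
      assume z: "z \<notin> C"
      have "pred_on.chain (Field P) (\<lambda>x y. (x, y) \<in> P) (insert z C)"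
        unfolding ch using C that re by blast
      then show False using L z unfolding maximal_chains_def pred_on.maxchain_def by blast
    qed
    with C show ?R by blast
  next
    assume ?R
    then show ?L unfolding maximal_chains_def pred_on.maxchain_def ch by blast
  qed
qed

lemma ex_maximal_chain:
  assumes "finite_poset P" "C \<subseteq> Field P" "\<forall>x\<in>C. \<forall>y\<in>C. (x, y) \<in> P \<or> (y, x) \<in> P"
  obtains M where "M \<in> maximal_chains P" "C \<subseteq> M"
proof -
  define \<C> where "\<C> = {D. D \<subseteq> Field P \<and> (\<forall>x\<in>D. \<forall>y\<in>D. (x, y) \<in> P \<or> (y, x) \<in> P)}"
  have "finite \<C>" by (rule finite_subset[of _ "Pow (Field P)"])
      (auto simp: \<C>_def finite_posetD(1)[OF assms(1)])
  moreover have "C \<in> \<C>" using assms by (simp add: \<C>_def)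
  ultimately obtain M where M: "M \<in> \<C>" "C \<subseteq> M" "\<forall>D\<in>\<C>. M \<subseteq> D \<longrightarrow> M = D"
    by (metis finite_has_maximal2)
  have "z \<in> M" if "z \<in> Field P" "\<forall>x\<in>M. (x, z) \<in> P \<or> (z, x) \<in> P" for z
  proof -
    have "insert z M \<in> \<C>" using M(1) that finite_posetD(5)[OF assms(1)] unfolding \<C>_def by blast
    then show ?thesis using M(3) by blast
  qed
  then have "M \<in> maximal_chains P" using M(1) unfolding maximal_chains_iff[OF assms(1)] \<C>_def by blast
  then show ?thesis using M(2) that by blast
qed

lemma ex_maximal_chain_pair:
  assumes "finite_poset P" "(p, q) \<in> P"
  obtains M where "M \<in> maximal_chains P" "p \<in> M" "q \<in> M"
  by (rule ex_maximal_chain[OF assms(1), of "{p, q}"])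
    (use assms finite_posetD(5)[OF assms(1)] in \<open>auto intro: FieldI1 FieldI2\<close>)

lemma chain_list:
  assumes "finite_poset P" "C \<in> maximal_chains P"
  shows "distinct (chain_list P C)" "set (chain_list P C) = C"
    "sorted_wrt (\<lambda>x y. (x, y) \<in> P) (chain_list P C)"
  using theI'[OF chain_list_ex1[OF assms]] by (auto simp: chain_list_def)

lemma chain_list_eqI:
  assumes "finite_poset P" "C \<in> maximal_chains P"
    "distinct xs" "set xs = C" "sorted_wrt (\<lambda>x y. (x, y) \<in> P) xs"
  shows "chain_list P C = xs"
  unfolding chain_list_def using chain_list_ex1[OF assms(1,2)] assms(3-5) by (intro the1_equality) auto

lemma ex_minimal_point:
  assumes "finite_poset P" "x \<in> Field P"
  obtains m where "m \<in> minimal_points P" "(m, x) \<in> P"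
  using assms(2)
proof (induction "card {y. (y, x) \<in> P}" arbitrary: x thesis rule: less_induct)
  case less
  note P = finite_posetD[OF assms(1)]
  show ?case
  proof (cases "x \<in> minimal_points P")
    case False
    then obtain y where y: "(y, x) \<in> P" "y \<noteq> x" using less.prems by (auto simp: minimal_points_def)
    have fin: "finite {z. (z, x) \<in> P}"
      by (rule finite_subset[OF _ P(1)]) (auto intro: FieldI1)
    have "x \<notin> {z. (z, y) \<in> P}" using y P(3) by (auto dest: antisymD)
    then have "card {z. (z, y) \<in> P} < card {z. (z, x) \<in> P}"
      by (intro psubset_card_mono[OF fin])
        (use y P(4) less.prems P(5) in \<open>auto simp: psubset_eq dest: transD\<close>)
    then show ?thesis
      using less.hyps[of y] less.prems(1) y P(4) by (metis FieldI1 transD)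
  qed (use less.prems P(5) in blast)
qed

lemma minimal_points_converse: "minimal_points (P\<inverse>) = maximal_points P"
  by (auto simp: minimal_points_def maximal_points_def)

lemma ex_maximal_point:
  assumes "finite_poset P" "x \<in> Field P"
  obtains m where "m \<in> maximal_points P" "(x, m) \<in> P"
proof -
  have "finite_poset (P\<inverse>)" using assms(1) by (simp add: finite_poset_def)
  then show ?thesis
    using ex_minimal_point[of "P\<inverse>" x] assms(2) that by (auto simp: minimal_points_converse)
qed

section \<open>Transport along injections\<close>

text \<open>The subdivision of \<open>P\<close> is built on triples, while a shuffle lives on
  \<open>nat\<close>; hence everything that \<open>is_shuffle\<close> mentions is carried along an
  injection. The injection is only required on the field, since it comes from a finite set.\<close>

lemma dir_image_iff:
  assumes "inj_on e (Field P)" "x \<in> Field P" "y \<in> Field P"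
  shows "(e x, e y) \<in> dir_image P e \<longleftrightarrow> (x, y) \<in> P"
proof
  assume "(e x, e y) \<in> dir_image P e"
  then obtain a b where "(a, b) \<in> P" "e a = e x" "e b = e y" by (auto simp: dir_image_def)
  moreover from this have "a \<in> Field P" "b \<in> Field P" by (auto intro: FieldI1 FieldI2)
  ultimately show "(x, y) \<in> P" using assms by (metis inj_onD)
qed (auto simp: dir_image_def)

lemma dir_imageE:
  assumes "(a, b) \<in> dir_image P e"
  obtains x y where "a = e x" "b = e y" "(x, y) \<in> P" "x \<in> Field P" "y \<in> Field P"
  using assms by (auto simp: dir_image_def intro: FieldI1 FieldI2)

lemma finite_poset_dir_image:
  assumes "finite_poset P" "inj_on e (Field P)"
  shows "finite_poset (dir_image P e)"
proof -
  have "dir_image P e = map_prod e e ` P" by (auto simp: dir_image_def)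
  then have "finite (dir_image P e)" using assms by (simp add: finite_poset_def)
  then show ?thesis using assms by (simp add: finite_poset_def Partial_order_dir_image)
qed

lemma minimal_points_dir_image:
  assumes "inj_on e (Field P)"
  shows "minimal_points (dir_image P e) = e ` minimal_points P"
proof -
  have "e x \<in> minimal_points (dir_image P e) \<longleftrightarrow> x \<in> minimal_points P" if x: "x \<in> Field P" for x
  proof -
    have "(\<forall>y. (y, e x) \<in> dir_image P e \<longrightarrow> y = e x) \<longleftrightarrow>
        (\<forall>y\<in>Field P. (e y, e x) \<in> dir_image P e \<longrightarrow> e y = e x)"
      by (auto elim: dir_imageE)
    also have "\<dots> \<longleftrightarrow> (\<forall>y\<in>Field P. (y, x) \<in> P \<longrightarrow> y = x)"
      using dir_image_iff[OF assms] inj_on_eq_iff[OF assms] x by simp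
    also have "\<dots> \<longleftrightarrow> (\<forall>y. (y, x) \<in> P \<longrightarrow> y = x)" by (auto intro: FieldI1)
    finally show ?thesis using x by (auto simp: minimal_points_def dir_image_Field)
  qed
  moreover have "minimal_points (dir_image P e) \<subseteq> e ` Field P" "minimal_points P \<subseteq> Field P"
    by (auto simp: minimal_points_def dir_image_Field)
  ultimately show ?thesis by blast
qed

lemma dir_image_converse: "(dir_image P e)\<inverse> = dir_image (P\<inverse>) e"
  by (auto simp: dir_image_def)

lemma maximal_points_dir_image:
  assumes "inj_on e (Field P)"
  shows "maximal_points (dir_image P e) = e ` maximal_points P"
  using minimal_points_dir_image[of e "P\<inverse>"] assms
  by (simp add: minimal_points_converse flip: dir_image_converse)

lemma maximal_chain_dir_imageI:
  assumes P: "finite_poset P" and e: "inj_on e (Field P)" and C: "C \<in> maximal_chains P"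
  shows "e ` C \<in> maximal_chains (dir_image P e)"
proof -
  have sub: "C \<subseteq> Field P" using C by (simp add: maximal_chains_iff[OF P])
  have "(e x, e y) \<in> dir_image P e \<or> (e y, e x) \<in> dir_image P e" if "x \<in> C" "y \<in> C" for x y
    using that C dir_image_iff[OF e] sub unfolding maximal_chains_iff[OF P] by blast
  moreover have "z \<in> C" if z: "z \<in> Field P"
    "\<forall>x\<in>C. (e x, e z) \<in> dir_image P e \<or> (e z, e x) \<in> dir_image P e" for z
  proof -
    have "\<forall>x\<in>C. (x, z) \<in> P \<or> (z, x) \<in> P" using z dir_image_iff[OF e] sub by blast
    then show ?thesis using C z(1) unfolding maximal_chains_iff[OF P] by blast
  qed
  ultimately show ?thesis
    using sub unfolding maximal_chains_iff[OF finite_poset_dir_image[OF P e]] dir_image_Field by blast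
qed

lemma maximal_chains_dir_image:
  assumes P: "finite_poset P" and e: "inj_on e (Field P)"
  shows "maximal_chains (dir_image P e) = (`) e ` maximal_chains P"
proof (intro equalityI subsetI)
  fix D assume D: "D \<in> maximal_chains (dir_image P e)"
  have P': "finite_poset (dir_image P e)" by (rule finite_poset_dir_image[OF P e])
  define C where "C = {x \<in> Field P. e x \<in> D}"
  have DC: "D = e ` C" using D unfolding C_def maximal_chains_iff[OF P'] dir_image_Field by auto
  have CF: "C \<subseteq> Field P" by (auto simp: C_def)
  have "C \<in> maximal_chains P" unfolding maximal_chains_iff[OF P]
  proof (intro conjI ballI impI)
    show "C \<subseteq> Field P" by (rule CF)
  next
    fix x y assume "x \<in> C" "y \<in> C"
    then show "(x, y) \<in> P \<or> (y, x) \<in> P"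
      using D dir_image_iff[OF e, of x y] dir_image_iff[OF e, of y x]
      unfolding maximal_chains_iff[OF P'] by (auto simp: C_def)
  next
    fix z assume z: "z \<in> Field P" "\<forall>x\<in>C. (x, z) \<in> P \<or> (z, x) \<in> P"
    then have "(x, e z) \<in> dir_image P e \<or> (e z, x) \<in> dir_image P e" if "x \<in> e ` C" for x
      using that z dir_image_iff[OF e] CF by (metis (no_types, lifting) imageE subsetD)
    then have "e z \<in> D" using D z(1) unfolding maximal_chains_iff[OF P'] dir_image_Field DC by blast
    then show "z \<in> C" using z(1) by (simp add: C_def)
  qed
  then show "D \<in> (`) e ` maximal_chains P" using DC by blast
qed (use maximal_chain_dir_imageI[OF assms] in auto)

lemma chain_list_dir_image:
  assumes P: "finite_poset P" and e: "inj_on e (Field P)" and C: "C \<in> maximal_chains P"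
  shows "chain_list (dir_image P e) (e ` C) = map e (chain_list P C)"
proof (rule chain_list_eqI[OF finite_poset_dir_image[OF P e] maximal_chain_dir_imageI[OF assms]])
  note cl = chain_list[OF P C]
  have sub: "C \<subseteq> Field P" using C by (simp add: maximal_chains_iff[OF P])
  show "distinct (map e (chain_list P C))"
    using cl sub e by (auto simp: distinct_map intro: inj_on_subset)
  show "sorted_wrt (\<lambda>x y. (x, y) \<in> dir_image P e) (map e (chain_list P C))"
    unfolding sorted_wrt_map
    by (rule sorted_wrt_mono_rel[OF _ cl(3)]) (auto simp: dir_image_def)
qed (simp add: chain_list[OF P C])

lemma chain_list_chain_poset: "chain_list (chain_poset n) {1..n} = [1..<Suc n]"
  unfolding chain_list_def
proof (rule the_equality)
  have "sorted [1..<Suc n]" by (rule sorted_upt)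
  then have "sorted_wrt (\<lambda>x y. (x, y) \<in> chain_poset n) [1..<Suc n]"
    by (rule sorted_wrt_mono_rel[rotated]) (auto simp: chain_poset_def)
  then show "distinct [1..<Suc n] \<and> set [1..<Suc n] = {1..n} \<and>
      sorted_wrt (\<lambda>x y. (x, y) \<in> chain_poset n) [1..<Suc n]"
    using distinct_upt by auto
  fix xs assume xs: "distinct xs \<and> set xs = {1..n} \<and> sorted_wrt (\<lambda>x y. (x, y) \<in> chain_poset n) xs"
  have "sorted xs" by (rule sorted_wrt_mono_rel[of xs "\<lambda>x y. (x, y) \<in> chain_poset n"])
      (use xs in \<open>auto simp: chain_poset_def\<close>)
  then show "xs = [1..<Suc n]"
  proof (rule sorted_distinct_set_unique)
    show "set xs = set [1..<Suc n]" using xs by (simp only: set_upt atLeastLessThanSuc_atLeastAtMost)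
  qed (use xs in \<open>simp_all only: sorted_upt distinct_upt\<close>)
qed

section \<open>Shuffles of a list with an interval\<close>

text \<open>The shuffle of \<open>xs\<close> with \<open>[k, \<dots>, m - 1]\<close> in which exactly the letters below \<open>f x\<close> precede \<open>x\<close>.\<close>

fun weave :: "('a \<Rightarrow> nat) \<Rightarrow> nat \<Rightarrow> nat \<Rightarrow> 'a list \<Rightarrow> ('a + nat) list" where
  "weave f k m [] = map Inr [k..<m]"
| "weave f k m (x # xs) = map Inr [k..<f x] @ Inl x # weave f (f x) m xs"

text \<open>The inverse reading of \<open>weave\<close>: it recovers \<open>f x\<close> from
  \<open>weave f k m xs\<close> up to the offset \<open>k\<close>.\<close>

definition letters_before :: "('a + nat) list \<Rightarrow> 'a \<Rightarrow> nat" where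
  "letters_before L x = length (filter (Not \<circ> isl) (takeWhile (\<lambda>c. c \<noteq> Inl x) L))"

lemma letters_before_simps:
  "letters_before (Inr j # L) x = Suc (letters_before L x)"
  "letters_before (Inl y # L) x = (if x = y then 0 else letters_before L x)"
  by (auto simp: letters_before_def)

lemma letters_before_Inr_append:
  "letters_before (map Inr js @ L) x = length js + letters_before L x"
  by (induction js) (simp_all add: letters_before_simps)

lemma weave_cong: "(\<And>x. x \<in> set xs \<Longrightarrow> f x = g x) \<Longrightarrow> weave f k m xs = weave g k m xs"
  by (induction xs arbitrary: k) simp_all

text \<open>Lets the induction on a shuffle step over a leading letter. For empty \<open>xs\<close>
  the letter exists because \<open>k < m\<close>, otherwise because the first point comes later than
  \<open>k\<close>.\<close>

lemma weave_Inr_Cons: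
  assumes "\<And>x. x \<in> set xs \<Longrightarrow> Suc k \<le> f x" "k < m"
  shows "weave f k m xs = Inr k # weave f (Suc k) m xs"
proof (cases xs)
  case (Cons x ys)
  then have "k < f x" using assms(1)[of x] by simp
  then show ?thesis using Cons by (simp add: upt_conv_Cons)
qed (use assms(2) in \<open>simp add: upt_conv_Cons\<close>)

text \<open>Induction on the shuffle. Removing a leading letter raises \<open>k\<close> and lowers
  every count by one, so \<open>k + letters_before L x\<close> is invariant; removing a leading
  point changes no other count, because \<open>xs\<close> is distinct.\<close>

lemma shuffle_eq_weave:
  assumes "L \<in> shuffles (map Inl xs) (map Inr [k..<m])" "distinct xs"
  shows "L = weave (\<lambda>x. k + letters_before L x) k m xs"
    "sorted (map (letters_before L) xs)"
  using assms
proof (induction L arbitrary: xs k)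
  case Nil
  case 1 then show ?case by simp
  case 2 then show ?case by simp
next
  case (Cons c L)
  have key: "c # L = weave (\<lambda>x. k + letters_before (c # L) x) k m xs \<and>
      sorted (map (letters_before (c # L)) xs)"
    if sh: "c # L \<in> shuffles (map Inl xs) (map Inr [k..<m])" and di: "distinct xs" for xs k
  proof -
    from sh consider (Inr) ys where "map Inr [k..<m] = c # ys" "L \<in> shuffles (map Inl xs) ys"
      | (Inl) ys where "map Inl xs = c # ys" "L \<in> shuffles ys (map Inr [k..<m])"
      by (cases "map Inl xs :: ('a + nat) list"; cases "map Inr [k..<m] :: ('a + nat) list")
        (auto simp: Cons_in_shuffles_iff)
    then show ?thesis
    proof cases
      case Inr
      then have km: "k < m" by (cases "k < m") auto
      then have c: "c = Inr k" and ys: "ys = map Inr [Suc k..<m]"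
        using Inr(1) by (simp_all add: upt_conv_Cons)
      have L: "L = weave (\<lambda>x. Suc k + letters_before L x) (Suc k) m xs"
        "sorted (map (letters_before L) xs)"
        using Cons.IH[of xs "Suc k"] Inr(2) di unfolding ys by blast+
      show ?thesis
        using L km unfolding c by (simp add: letters_before_simps weave_Inr_Cons sorted_map)
    next
      case Inl
      then obtain x xs' where xs: "xs = x # xs'" "c = Inl x" "ys = map Inl xs'" by (cases xs) auto
      have L: "L = weave (\<lambda>x. k + letters_before L x) k m xs'"
        "sorted (map (letters_before L) xs')"
        using Cons.IH[of xs' k] Inl(2) di unfolding xs by auto
      have eq: "letters_before (c # L) y = letters_before L y" if "y \<in> set xs'" for y
        using that di by (auto simp: xs letters_before_simps)
      have "weave (\<lambda>x. k + letters_before (c # L) x) k m xs' = L"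
        using L(1) eq by (metis (mono_tags, lifting) weave_cong)
      moreover have m: "map (letters_before (c # L)) xs' = map (letters_before L) xs'"
        by (rule map_cong[OF refl eq])
      have "sorted (map (letters_before (c # L)) xs')" unfolding m by (rule L(2))
      moreover have "letters_before (c # L) x = 0" by (simp add: xs(2) letters_before_simps)
      ultimately show ?thesis unfolding xs(1) by (simp add: xs(2))
    qed
  qed
  case 1 then show ?case using key by blast
  case 2 then show ?case using key by blast
qed

text \<open>By monotony and the bounds, the intervals that \<open>weave\<close> inserts between the
  points concatenate to \<open>[k..<m]\<close>.\<close>

lemma weave_in_shuffles:
  assumes "sorted (map f xs)" "\<And>x. x \<in> set xs \<Longrightarrow> k \<le> f x \<and> f x \<le> m"
  shows "weave f k m xs \<in> shuffles (map Inl xs) (map Inr [k..<m])"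
  using assms
proof (induction xs arbitrary: k)
  case (Cons x xs)
  have right: "ys @ zs \<in> shuffles us (ys @ vs)" if "zs \<in> shuffles us vs" for ys zs us vs :: "('a + nat) list"
    using that by (induction ys) (auto intro: Cons_in_shuffles_rightI)
  have "weave f (f x) m xs \<in> shuffles (map Inl xs) (map Inr [f x..<m])"
    using Cons.prems by (intro Cons.IH) auto
  then have "Inl x # weave f (f x) m xs \<in> shuffles (map Inl (x # xs)) (map Inr [f x..<m])"
    by (auto intro: Cons_in_shuffles_leftI)
  moreover have "[k..<m] = [k..<f x] @ [f x..<m]"
    using Cons.prems(2)[of x] by (metis le_add_diff_inverse list.set_intros(1) upt_add_eq_append)
  ultimately show ?case using right by (simp add: right)
qed simp

text \<open>The intervals inserted before \<open>x\<close> telescope to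
  \<open>[k..<f x]\<close>.\<close>

lemma letters_before_weave:
  assumes "sorted (map f xs)" "\<And>x. x \<in> set xs \<Longrightarrow> k \<le> f x" "x \<in> set xs" "distinct xs"
  shows "k + letters_before (weave f k m xs) x = f x"
  using assms
proof (induction xs arbitrary: k)
  case (Cons y xs)
  show ?case
  proof (cases "x = y")
    case False
    then have "f y + letters_before (weave f (f y) m xs) x = f x"
      using Cons.prems by (intro Cons.IH) auto
    then show ?thesis using False Cons.prems(2)[of y]
      by (simp add: letters_before_Inr_append letters_before_simps)
  qed (use Cons.prems(2)[of y] in \<open>simp add: letters_before_Inr_append letters_before_simps\<close>)
qed simp

section \<open>Order polynomials of sums\<close>

text \<open>The relation \<open>R\<close> is left open so that one bijection serves both sums: for
  \<open>\<squnion>\<close> it treats the two parts separately, for \<open>\<oplus>\<close> it also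
  compares values across them.\<close>

lemma PiE_Un_split:
  assumes "A \<inter> B = {}"
  shows "bij_betw (\<lambda>h. (restrict h A, restrict h B))
    {h \<in> A \<union> B \<rightarrow>\<^sub>E T. R (restrict h A) (restrict h B)}
    {(f, g). f \<in> A \<rightarrow>\<^sub>E T \<and> g \<in> B \<rightarrow>\<^sub>E T \<and> R f g}"
proof (rule bij_betwI[where g = "\<lambda>(f, g) x. if x \<in> A then f x else g x"])
  have r: "restrict (\<lambda>x. if x \<in> A then f x else g x) A = f"
    "restrict (\<lambda>x. if x \<in> A then f x else g x) B = g"
    if "f \<in> A \<rightarrow>\<^sub>E T" "g \<in> B \<rightarrow>\<^sub>E T" for f g
    using that assms by (auto simp: fun_eq_iff PiE_def extensional_def)
  show "(\<lambda>(f, g) x. if x \<in> A then f x else g x) \<in> {(f, g). f \<in> A \<rightarrow>\<^sub>E T \<and> g \<in> B \<rightarrow>\<^sub>E T \<and> R f g} \<rightarrow>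
      {h \<in> A \<union> B \<rightarrow>\<^sub>E T. R (restrict h A) (restrict h B)}"
  proof (intro funcsetI)
    fix fg assume "fg \<in> {(f, g). f \<in> A \<rightarrow>\<^sub>E T \<and> g \<in> B \<rightarrow>\<^sub>E T \<and> R f g}"
    then obtain f g where fg: "fg = (f, g)" "f \<in> A \<rightarrow>\<^sub>E T" "g \<in> B \<rightarrow>\<^sub>E T" "R f g" by blast
    have "(\<lambda>x. if x \<in> A then f x else g x) \<in> A \<union> B \<rightarrow>\<^sub>E T"
      using fg(2,3) by (auto simp: PiE_def extensional_def)
    then show "(\<lambda>(f, g) x. if x \<in> A then f x else g x) fg \<in>
        {h \<in> A \<union> B \<rightarrow>\<^sub>E T. R (restrict h A) (restrict h B)}"
      using fg(1,4) r[OF fg(2,3)] by simp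
  qed
  show "(\<lambda>h. (restrict h A, restrict h B)) ((\<lambda>(f, g) x. if x \<in> A then f x else g x) fg) = fg"
    if "fg \<in> {(f, g). f \<in> A \<rightarrow>\<^sub>E T \<and> g \<in> B \<rightarrow>\<^sub>E T \<and> R f g}" for fg
    using that r by (cases fg) simp
  show "(\<lambda>h. (restrict h A, restrict h B)) \<in> {h \<in> A \<union> B \<rightarrow>\<^sub>E T. R (restrict h A) (restrict h B)} \<rightarrow>
      {(f, g). f \<in> A \<rightarrow>\<^sub>E T \<and> g \<in> B \<rightarrow>\<^sub>E T \<and> R f g}"
    by (auto simp: PiE_def)
  show "(\<lambda>(f, g) x. if x \<in> A then f x else g x) (restrict h A, restrict h B) = h"
    if "h \<in> {h \<in> A \<union> B \<rightarrow>\<^sub>E T. R (restrict h A) (restrict h B)}" for h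
    using that by (auto simp: fun_eq_iff PiE_def extensional_def)
qed

lemma finite_weak_maps: "finite (Field P) \<Longrightarrow> finite (weak_maps P n)"
  by (rule finite_subset[OF _ finite_PiE[of "Field P" "\<lambda>_. {1..n}"]]) (auto simp: weak_maps_def)

lemma Field_sums:
  "Field (disjoint_sum P Q) = Field P \<union> Field Q" "Field (ordinal_sum P Q) = Field P \<union> Field Q"
  by (auto simp: disjoint_sum_def ordinal_sum_def Field_def)

lemma card_weak_maps_disjoint_sum:
  assumes "Field P \<inter> Field Q = {}"
  shows "card (weak_maps (disjoint_sum P Q) n) = card (weak_maps P n) * card (weak_maps Q n)"
proof -
  define R where "R f g \<longleftrightarrow> (\<forall>x y. (x, y) \<in> P \<longrightarrow> f x \<le> f y) \<and> (\<forall>x y. (x, y) \<in> Q \<longrightarrow> g x \<le> g y)"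
    for f g :: "'a \<Rightarrow> nat"
  have "weak_maps (disjoint_sum P Q) n =
      {h \<in> Field P \<union> Field Q \<rightarrow>\<^sub>E {1..n}. R (restrict h (Field P)) (restrict h (Field Q))}"
    unfolding weak_maps_def Field_sums R_def by (auto simp: disjoint_sum_def FieldI1 FieldI2)
  moreover have "weak_maps P n \<times> weak_maps Q n =
      {(f, g). f \<in> Field P \<rightarrow>\<^sub>E {1..n} \<and> g \<in> Field Q \<rightarrow>\<^sub>E {1..n} \<and> R f g}"
    by (auto simp: weak_maps_def R_def)
  ultimately show ?thesis
    using bij_betw_same_card[OF PiE_Un_split[OF assms, of "{1..n}" R]] by (simp flip: card_cartesian_product)
qed

lemma weak_maps_mono: "m \<le> n \<Longrightarrow> weak_maps P m \<subseteq> weak_maps P n"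
  by (fastforce simp: weak_maps_def PiE_def Pi_def)

lemma weak_maps_0: "Field P \<noteq> {} \<Longrightarrow> weak_maps P 0 = {}"
  by (auto simp: weak_maps_def PiE_def Pi_def)

text \<open>Lowering all values by \<open>k - 1\<close> takes \<open>{k..n}\<close> to
  \<open>{1..Suc n - k}\<close>; \<open>1 \<le> k\<close> keeps the truncated subtractions
  exact.\<close>

lemma card_weak_maps_ge:
  assumes "1 \<le> k" "k \<le> n"
  shows "card {g \<in> weak_maps Q n. \<forall>q\<in>Field Q. k \<le> g q} = card (weak_maps Q (Suc n - k))"
proof (rule bij_betw_same_card[where f = "\<lambda>g. restrict (\<lambda>q. Suc (g q) - k) (Field Q)"],
    rule bij_betwI[where g = "\<lambda>g. restrict (\<lambda>q. g q + k - 1) (Field Q)"])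
  show "(\<lambda>g. \<lambda>q\<in>Field Q. Suc (g q) - k) \<in>
      {g \<in> weak_maps Q n. \<forall>q\<in>Field Q. k \<le> g q} \<rightarrow> weak_maps Q (Suc n - k)"
    using assms by (fastforce simp: weak_maps_def FieldI1 FieldI2 intro: diff_le_mono)
  show "(\<lambda>g. \<lambda>q\<in>Field Q. g q + k - 1) \<in>
      weak_maps Q (Suc n - k) \<rightarrow> {g \<in> weak_maps Q n. \<forall>q\<in>Field Q. k \<le> g q}"
    using assms by (fastforce simp: weak_maps_def FieldI1 FieldI2 PiE_def Pi_def)
  show "(\<lambda>q\<in>Field Q. (\<lambda>q\<in>Field Q. Suc (g q) - k) q + k - 1) = g"
    if "g \<in> {g \<in> weak_maps Q n. \<forall>q\<in>Field Q. k \<le> g q}" for g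
    using that by (fastforce simp: weak_maps_def fun_eq_iff PiE_def extensional_def)
  show "(\<lambda>q\<in>Field Q. Suc ((\<lambda>q\<in>Field Q. g q + k - 1) q) - k) = g"
    if "g \<in> weak_maps Q (Suc n - k)" for g
    using that assms by (fastforce simp: weak_maps_def fun_eq_iff PiE_def extensional_def)
qed

text \<open>The index \<open>k\<close> is the largest value on \<open>P\<close>.\<close>

lemma card_weak_maps_ordinal_sum:
  assumes dj: "Field P \<inter> Field Q = {}" and fin: "finite (Field P)" "finite (Field Q)"
    and ne: "Field P \<noteq> {}"
  shows "card (weak_maps (ordinal_sum P Q) n) =
    (\<Sum>k = 1..n. (card (weak_maps P k) - card (weak_maps P (k - 1))) * card (weak_maps Q (Suc n - k)))"
proof -
  define R where "R f g \<longleftrightarrow> (\<forall>x y. (x, y) \<in> P \<longrightarrow> f x \<le> f y) \<and> (\<forall>x y. (x, y) \<in> Q \<longrightarrow> g x \<le> g y) \<and>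
    (\<forall>x\<in>Field P. \<forall>y\<in>Field Q. f x \<le> g y)" for f g :: "'a \<Rightarrow> nat"
  \<comment> \<open>A difference of nested sets, so that its cardinality is a difference as well;
    for \<open>k\<close> in \<open>{1..n}\<close> it consists of the maps with maximum exactly
    \<open>k\<close>.\<close>
  define D where "D k = weak_maps P k - weak_maps P (k - 1)" for k
  define U where "U k = {g \<in> weak_maps Q n. \<forall>q\<in>Field Q. k \<le> g q}" for k
  have D: "f \<in> D k \<longleftrightarrow> f \<in> weak_maps P n \<and> Max (f ` Field P) = k" if k: "k \<in> {1..n}" for f k
  proof -
    have le: "Max (f ` Field P) \<le> j \<longleftrightarrow> (\<forall>p\<in>Field P. f p \<le> j)" for j using fin ne by simp
    have eq: "f \<in> weak_maps P j \<longleftrightarrow> f \<in> weak_maps P n \<and> Max (f ` Field P) \<le> j" if "j \<le> n" for j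
      unfolding le using that by (fastforce simp: weak_maps_def PiE_def Pi_def)
    have k1: "k \<le> n" "k - 1 \<le> n" using k by auto
    have "f \<in> D k \<longleftrightarrow> f \<in> weak_maps P n \<and> Max (f ` Field P) \<le> k \<and> \<not> Max (f ` Field P) \<le> k - 1"
      unfolding D_def Diff_iff eq[OF k1(1)] eq[OF k1(2)] by blast
    moreover have "a \<le> k \<and> \<not> a \<le> k - 1 \<longleftrightarrow> a = k" for a using k by auto
    ultimately show ?thesis by simp
  qed
  have "weak_maps (ordinal_sum P Q) n =
      {h \<in> Field P \<union> Field Q \<rightarrow>\<^sub>E {1..n}. R (restrict h (Field P)) (restrict h (Field Q))}"
  proof -
    have "(\<forall>x y. (x, y) \<in> ordinal_sum P Q \<longrightarrow> h x \<le> h y) \<longleftrightarrow>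
        R (restrict h (Field P)) (restrict h (Field Q))" for h :: "'a \<Rightarrow> nat"
    proof -
      have "R (restrict h (Field P)) (restrict h (Field Q)) \<longleftrightarrow> (\<forall>x y. (x, y) \<in> P \<longrightarrow> h x \<le> h y) \<and>
          (\<forall>x y. (x, y) \<in> Q \<longrightarrow> h x \<le> h y) \<and> (\<forall>x\<in>Field P. \<forall>y\<in>Field Q. h x \<le> h y)"
        by (simp add: R_def FieldI1 FieldI2 cong: conj_cong)
      also have "\<dots> \<longleftrightarrow> (\<forall>x y. (x, y) \<in> ordinal_sum P Q \<longrightarrow> h x \<le> h y)"
        unfolding ordinal_sum_def by blast
      finally show ?thesis by simp
    qed
    then show ?thesis unfolding weak_maps_def Field_sums by simp
  qed
  \<comment> \<open>The values of \<open>f\<close> lie below those of \<open>g\<close> as soon as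
    the maximum of \<open>f\<close> does, and this maximum is attained because
    \<open>Field P\<close> is nonempty.\<close>
  moreover have "(\<Union>k\<in>{1..n}. D k \<times> U k) =
      {(f, g). f \<in> Field P \<rightarrow>\<^sub>E {1..n} \<and> g \<in> Field Q \<rightarrow>\<^sub>E {1..n} \<and> R f g}" (is "?L = ?R")
  proof (intro equalityI subsetI; clarify)
    fix f g k assume k: "k \<in> {1..n}" "f \<in> D k" "g \<in> U k"
    then have "f p \<le> k" if "p \<in> Field P" for p using D[OF k(1)] fin that by (auto intro: Max_ge)
    then have "f p \<le> g q" if "p \<in> Field P" "q \<in> Field Q" for p q
      using k(3) that unfolding U_def by (auto intro: order_trans)
    then show "f \<in> Field P \<rightarrow>\<^sub>E {1..n} \<and> g \<in> Field Q \<rightarrow>\<^sub>E {1..n} \<and> R f g"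
      using k D[OF k(1)] by (auto simp: R_def U_def weak_maps_def)
  next
    fix f g assume fg: "f \<in> Field P \<rightarrow>\<^sub>E {1..n}" "g \<in> Field Q \<rightarrow>\<^sub>E {1..n}" "R f g"
    define k where "k = Max (f ` Field P)"
    have "k \<in> f ` Field P" unfolding k_def using fin ne by (intro Max_in) auto
    then obtain p where p: "p \<in> Field P" "k = f p" by blast
    then have k: "k \<in> {1..n}" using fg by auto
    moreover have "f \<in> D k" unfolding D[OF k] using fg by (auto simp: weak_maps_def R_def k_def)
    moreover have "g \<in> U k" using fg p by (auto simp: U_def weak_maps_def R_def)
    ultimately show "(f, g) \<in> ?L" by blast
  qed
  ultimately have "card (weak_maps (ordinal_sum P Q) n) = card (\<Union>k\<in>{1..n}. D k \<times> U k)"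
    using bij_betw_same_card[OF PiE_Un_split[OF dj, of "{1..n}" R]] by simp
  also have "\<dots> = (\<Sum>k = 1..n. card (D k \<times> U k))"
  proof (rule card_UN_disjoint)
    have "finite (D k)" "finite (U k)" for k
      using finite_weak_maps[OF fin(1)] finite_weak_maps[OF fin(2)] by (auto simp: D_def U_def)
    then show "\<forall>k\<in>{1..n}. finite (D k \<times> U k)" by blast
  qed (use D in auto)
  also have "\<dots> = (\<Sum>k = 1..n. (card (weak_maps P k) - card (weak_maps P (k - 1))) * card (weak_maps Q (Suc n - k)))"
  proof (rule sum.cong)
    fix k assume k: "k \<in> {1..n}"
    have "card (D k) = card (weak_maps P k) - card (weak_maps P (k - 1))"
      unfolding D_def by (rule card_Diff_subset[OF finite_weak_maps[OF fin(1)] weak_maps_mono]) simp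
    moreover have "card (U k) = card (weak_maps Q (Suc n - k))"
      unfolding U_def by (rule card_weak_maps_ge) (use k in auto)
    ultimately show "card (D k \<times> U k) =
        (card (weak_maps P k) - card (weak_maps P (k - 1))) * card (weak_maps Q (Suc n - k))"
      by (simp add: card_cartesian_product)
  qed simp
  finally show ?thesis .
qed

section \<open>The weak order-preserving map of a shuffle\<close>

text \<open>An element comparable with the whole spliced chain is comparable with \<open>a\<close>.
  If it lies below \<open>a\<close>, it also lies below the upper part of \<open>C\<close>, so it is
  comparable with all of \<open>C\<close> and belongs to \<open>C\<close> by maximality; above
  \<open>a\<close> the same holds with \<open>D\<close>.\<close>

lemma maximal_chains_exchange:
  assumes P: "finite_poset P" and C: "C \<in> maximal_chains P" "D \<in> maximal_chains P"
    and a: "a \<in> C" "a \<in> D"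
  shows "{b \<in> C. (b, a) \<in> P} \<union> {b \<in> D. (a, b) \<in> P} \<in> maximal_chains P" (is "?E \<in> _")
proof -
  note C' = C[unfolded maximal_chains_iff[OF P]]
  have tr: "(x, z) \<in> P" if "(x, y) \<in> P" "(y, z) \<in> P" for x y z
    using that finite_posetD(4)[OF P] by (blast dest: transD)
  have aE: "a \<in> ?E" using a C' finite_posetD(5)[OF P] by blast
  have "?E \<subseteq> Field P" using C' by blast
  moreover have "(x, y) \<in> P \<or> (y, x) \<in> P" if "x \<in> ?E" "y \<in> ?E" for x y
    using that C' tr by blast
  moreover have "z \<in> ?E" if z: "z \<in> Field P" "\<forall>x\<in>?E. (x, z) \<in> P \<or> (z, x) \<in> P" for z
  proof -
    consider "(z, a) \<in> P" | "(a, z) \<in> P" using z(2) aE by blast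
    then show ?thesis
    proof cases
      case 1
      have "(x, z) \<in> P \<or> (z, x) \<in> P" if "x \<in> C" for x
      proof (cases "(x, a) \<in> P")
        case True then show ?thesis using z(2) that by blast
      next
        case False
        then have "(a, x) \<in> P" using C' a that by blast
        then show ?thesis using 1 tr by blast
      qed
      then have "z \<in> C" using C' z(1) by blast
      then show ?thesis using 1 by blast
    next
      case 2
      have "(x, z) \<in> P \<or> (z, x) \<in> P" if "x \<in> D" for x
      proof (cases "(a, x) \<in> P")
        case True then show ?thesis using z(2) that by blast
      next
        case False
        then have "(x, a) \<in> P" using C' a that by blast
        then show ?thesis using 2 tr by blast
      qed
      then have "z \<in> D" using C' z(1) by blast
      then show ?thesis using 2 by blast
    qed
  qed
  ultimately show ?thesis unfolding maximal_chains_iff[OF P] by blast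
qed

text \<open>Turns the prefix counted by \<open>letters_before\<close> into a set given by the order
  alone, to which the splicing of chains applies.\<close>

lemma set_takeWhile_sorted:
  assumes "antisym P" "sorted_wrt (\<lambda>x y. (x, y) \<in> P) xs" "distinct xs" "a \<in> set xs"
  shows "set (takeWhile (\<lambda>b. b \<noteq> a) xs) = {b \<in> set xs. (b, a) \<in> P \<and> b \<noteq> a}"
proof -
  obtain us vs where xs: "xs = us @ a # vs" using assms(4) by (meson split_list)
  have us: "a \<notin> set us" using assms(3) by (simp add: xs)
  then have "takeWhile (\<lambda>b. b \<noteq> a) xs = us" unfolding xs by (induction us) auto
  moreover have "(b, a) \<in> P" if "b \<in> set us" for b using assms(2) that by (auto simp: xs sorted_wrt_append)
  moreover have "b = a" if "b \<in> set (a # vs)" "(b, a) \<in> P" for b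
    using assms(1,2) that by (auto simp: xs sorted_wrt_append dest: antisymD)
  ultimately show ?thesis using us by (auto simp: xs)
qed

lemma length_filter_map_distinct:
  "distinct xs \<Longrightarrow> length (filter Q (map l xs)) = card {x \<in> set xs. Q (l x)}"
  using distinct_length_filter[of xs "Q \<circ> l"] by (simp add: filter_map Int_def conj_commute comp_def)

text \<open>
  If two maximal chains of a shuffle pass through the point labelled \<open>p\<close>, then the lower part of one and
  the upper part of the other form a third one, on which the letters again occur exactly once. So the
  number of letters below \<open>p\<close> is the same on both chains.
\<close>

lemma shuffle_weave:
  assumes P: "finite_poset P" and s: "is_shuffle P n s"
  obtains f where "f \<in> weak_maps P (Suc n)"
    "\<And>M. M \<in> maximal_chains P \<Longrightarrow> label_sequence s M = weave f 1 (Suc n) (chain_list P M)"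
proof -
  obtain A l \<Phi> where sA: "s = (A, l, \<Phi>)" by (cases s)
  define L where "L = label_sequence s"
  have A: "finite_poset A"
    and pt: "\<And>p. p \<in> Field P \<Longrightarrow> \<exists>!a. a \<in> Field A \<and> l a = Inl p"
    and bij: "bij_betw \<Phi> (maximal_chains P) (maximal_chains A)"
    and sh: "\<And>M. M \<in> maximal_chains P \<Longrightarrow>
      L M \<in> shuffles (map Inl (chain_list P M)) (map Inr [1..<Suc n])"
    using s by (auto simp: sA is_shuffle_def L_def chain_list_chain_poset simp del: upt_Suc One_nat_def)
  have L: "L M = map l (chain_list A (\<Phi> M))" for M by (simp add: L_def sA label_sequence_def)
  have \<Phi>: "\<Phi> M \<in> maximal_chains A" if "M \<in> maximal_chains P" for M
    using bij that by (auto simp: bij_betw_def)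
  have inA: "a \<in> Field A" if "a \<in> C" "C \<in> maximal_chains A" for a C
    using that by (auto simp: maximal_chains_iff[OF A])
  have inP: "p \<in> Field P" if "p \<in> M" "M \<in> maximal_chains P" for p M
    using that by (auto simp: maximal_chains_iff[OF P])
  \<comment> \<open>Filtering commutes with shuffling: once the points of \<open>P\<close> are
    removed, only the \<open>n\<close> letters are left.\<close>
  have letters_L: "length (filter (Not \<circ> isl) (L M)) = n" if "M \<in> maximal_chains P" for M
  proof -
    have "filter (Not \<circ> isl) (L M) \<in> shuffles (filter (Not \<circ> isl) (map Inl (chain_list P M)))
        (filter (Not \<circ> isl) (map Inr [1..<Suc n]))"
      using sh[OF that] by (subst filter_shuffles[symmetric]) blast
    then show ?thesis by (simp add: filter_map comp_def del: upt_Suc)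
  qed
  \<comment> \<open>Surjectivity of \<open>\<Phi>\<close> extends the count to all maximal chains of
    \<open>A\<close>, in particular to spliced ones, which are not given as images.\<close>
  have letters: "card {b \<in> C. \<not> isl (l b)} = n" if C: "C \<in> maximal_chains A" for C
  proof -
    obtain M where M: "M \<in> maximal_chains P" "\<Phi> M = C" using bij C by (metis bij_betw_imp_surj_on imageE)
    show ?thesis
      using letters_L[OF M(1)] length_filter_map_distinct[OF chain_list(1)[OF A C], of "Not \<circ> isl" l]
      by (simp add: L M(2) chain_list(2)[OF A C])
  qed
  have on_chain: "a \<in> \<Phi> M"
    if M: "M \<in> maximal_chains P" and p: "p \<in> M" and a: "a \<in> Field A" "l a = Inl p" for M p a
  proof -
    have "Inl p \<in> set (L M)"
      using p set_shuffles[OF sh[OF M]] by (simp add: chain_list(2)[OF P M])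
    then obtain b where b: "b \<in> \<Phi> M" "l b = Inl p"
      using chain_list(2)[OF A \<Phi>[OF M]] by (auto simp: L)
    then have "b = a" using pt[OF inP[OF p M]] inA[OF b(1) \<Phi>[OF M]] a by metis
    then show ?thesis using b by simp
  qed
  have before: "letters_before (L M) p = card {b \<in> \<Phi> M. (b, a) \<in> A \<and> \<not> isl (l b)}"
    if M: "M \<in> maximal_chains P" and p: "p \<in> M" and a: "a \<in> Field A" "l a = Inl p" for M p a
  proof -
    let ?cs = "chain_list A (\<Phi> M)"
    note cs = chain_list[OF A \<Phi>[OF M]]
    have "l b = Inl p \<longleftrightarrow> b = a" if "b \<in> set ?cs" for b
      using that pt[OF inP[OF p M]] a inA[OF _ \<Phi>[OF M]] cs(2) by metis
    then have "takeWhile (\<lambda>c. c \<noteq> Inl p) (L M) = map l (takeWhile (\<lambda>b. b \<noteq> a) ?cs)"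
      unfolding L takeWhile_map comp_def
      by (intro arg_cong[where f = "map l"] takeWhile_cong) auto
    then have "letters_before (L M) p =
        card {b \<in> set (takeWhile (\<lambda>b. b \<noteq> a) ?cs). (Not \<circ> isl) (l b)}"
      unfolding letters_before_def using length_filter_map_distinct[OF distinct_takeWhile[OF cs(1)]] by metis
    also have "{b \<in> set (takeWhile (\<lambda>b. b \<noteq> a) ?cs). (Not \<circ> isl) (l b)} =
        {b \<in> \<Phi> M. (b, a) \<in> A \<and> \<not> isl (l b)}"
      using set_takeWhile_sorted[OF finite_posetD(3)[OF A] cs(3,1)] on_chain[OF M p a] a(2) cs(2) by auto
    finally show ?thesis .
  qed
  have same: "letters_before (L M) p = letters_before (L N) p"
    if M: "M \<in> maximal_chains P" "p \<in> M" and N: "N \<in> maximal_chains P" "p \<in> N" for M N p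
  proof -
    obtain a where a: "a \<in> Field A" "l a = Inl p" using pt[OF inP[OF M(2,1)]] by blast
    have aM: "a \<in> \<Phi> M" "a \<in> \<Phi> N" using on_chain M N a by blast+
    have fin: "finite (\<Phi> K)" if "K \<in> maximal_chains P" for K
      using \<Phi>[OF that] finite_subset[OF _ finite_posetD(1)[OF A]] by (auto simp: maximal_chains_iff[OF A])
    \<comment> \<open>Used twice with \<open>K = N\<close>: the lower letters on
      \<open>\<Phi> M\<close> and those on \<open>\<Phi> N\<close> both complete the same upper
      letters of \<open>\<Phi> N\<close> to \<open>n\<close>.\<close>
    have split: "card {b \<in> \<Phi> M. (b, a) \<in> A \<and> \<not> isl (l b)} + card {b \<in> \<Phi> K. (a, b) \<in> A \<and> \<not> isl (l b)} = n"
      if K: "K \<in> maximal_chains P" "a \<in> \<Phi> K" and M: "M \<in> maximal_chains P" "a \<in> \<Phi> M" for M K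
    proof -
      let ?E = "{b \<in> \<Phi> M. (b, a) \<in> A} \<union> {b \<in> \<Phi> K. (a, b) \<in> A}"
      have "?E \<in> maximal_chains A"
        by (rule maximal_chains_exchange[OF A \<Phi>[OF M(1)] \<Phi>[OF K(1)] M(2) K(2)])
      then have "card {b \<in> ?E. \<not> isl (l b)} = n" by (rule letters)
      also have "{b \<in> ?E. \<not> isl (l b)} =
          {b \<in> \<Phi> M. (b, a) \<in> A \<and> \<not> isl (l b)} \<union> {b \<in> \<Phi> K. (a, b) \<in> A \<and> \<not> isl (l b)}" by blast
      \<comment> \<open>The two halves meet at most in \<open>a\<close>, which is labelled by a
        point of \<open>P\<close> and not by a letter.\<close>
      also have "card \<dots> = card {b \<in> \<Phi> M. (b, a) \<in> A \<and> \<not> isl (l b)} + card {b \<in> \<Phi> K. (a, b) \<in> A \<and> \<not> isl (l b)}"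
        using fin[OF M(1)] fin[OF K(1)] a(2) finite_posetD(3)[OF A]
        by (intro card_Un_disjoint) (auto dest: antisymD)
      finally show ?thesis .
    qed
    show ?thesis
      using split[OF N(1) aM(2) M(1) aM(1)] split[OF N(1) aM(2) N(1) aM(2)] before[OF M a] before[OF N a]
      by simp
  qed
  \<comment> \<open>The successor makes \<open>f p\<close> the first letter after \<open>p\<close>,
    or \<open>n + 1\<close> if there is none. The choice of the chain does not matter, by
    \<open>same\<close>.\<close>
  define f where "f = (\<lambda>p\<in>Field P. Suc (letters_before (L (SOME M. M \<in> maximal_chains P \<and> p \<in> M)) p))"
  have f: "f p = Suc (letters_before (L M) p)" if "M \<in> maximal_chains P" "p \<in> M" for M p
  proof -
    define N where "N = (SOME M. M \<in> maximal_chains P \<and> p \<in> M)"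
    have "N \<in> maximal_chains P \<and> p \<in> N" unfolding N_def by (rule someI, rule conjI[OF that])
    then show ?thesis using same[of N p M] that inP[OF that(2,1)] by (simp add: f_def N_def[symmetric])
  qed
  have "f \<in> weak_maps P (Suc n)"
    unfolding weak_maps_def
  proof (intro CollectI conjI allI impI)
    show "f \<in> Field P \<rightarrow>\<^sub>E {1..Suc n}"
    proof
      fix p assume "p \<in> Field P"
      then obtain M where M: "M \<in> maximal_chains P" "p \<in> M"
        using ex_maximal_chain_pair[OF P finite_posetD(5)[OF P]] by metis
      have "length (filter (Not \<circ> isl) (takeWhile (\<lambda>c. c \<noteq> Inl p) (L M))) \<le> length (filter (Not \<circ> isl) (L M))"
        by (metis filter_append le_add1 length_append takeWhile_dropWhile_id)
      then show "f p \<in> {1..Suc n}"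
        using f[OF M] letters_L[OF M(1)] by (simp add: letters_before_def)
    qed (simp add: f_def)
  next
    fix p q assume pq: "(p, q) \<in> P"
    then obtain M where M: "M \<in> maximal_chains P" "p \<in> M" "q \<in> M"
      using ex_maximal_chain_pair[OF P] by metis
    note cl = chain_list[OF P M(1)]
    have so: "sorted (map (letters_before (L M)) (chain_list P M))"
      by (rule shuffle_eq_weave(2)[OF sh[OF M(1)] cl(1)])
    obtain us vs where uv: "chain_list P M = us @ p # vs" using M(2) cl(2) by (metis split_list)
    have "q \<in> set (p # vs)"
      using cl M(3) pq finite_posetD(3)[OF P] by (auto simp: uv sorted_wrt_append dest: antisymD)
    then have "letters_before (L M) p \<le> letters_before (L M) q"
      using so by (auto simp: uv sorted_append)
    then show "f p \<le> f q" using f M by simp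
  qed
  moreover have "L M = weave f 1 (Suc n) (chain_list P M)" if M: "M \<in> maximal_chains P" for M
  proof -
    have "L M = weave (\<lambda>p. 1 + letters_before (L M) p) 1 (Suc n) (chain_list P M)"
      by (rule shuffle_eq_weave(1)[OF sh[OF M] chain_list(1)[OF P M]])
    also have "\<dots> = weave f 1 (Suc n) (chain_list P M)"
      by (rule weave_cong) (use f[OF M] chain_list(2)[OF P M] in simp)
    finally show ?thesis .
  qed
  ultimately show ?thesis using that by (simp add: L_def)
qed

section \<open>The shuffle of a weak order-preserving map\<close>

definition covers :: "'a rel \<Rightarrow> 'a \<Rightarrow> 'a \<Rightarrow> bool" where
  "covers P p q \<longleftrightarrow> (p, q) \<in> P \<and> p \<noteq> q \<and> (\<forall>r. (p, r) \<in> P \<and> (r, q) \<in> P \<longrightarrow> r = p \<or> r = q)"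

text \<open>
  The Hasse diagram of \<open>P\<close>, extended by a bottom and a top (both written \<^const>\<open>None\<close>), is subdivided:
  \<open>(d, u, j)\<close> is the point with letter \<open>j\<close> on the edge from \<open>d\<close> to \<open>u\<close>, while the original point \<open>p\<close>
  becomes the degenerate edge \<open>(Some p, Some p, f p)\<close>.
\<close>

inductive_set subdiv_points :: "'a rel \<Rightarrow> ('a \<Rightarrow> nat) \<Rightarrow> nat \<Rightarrow> ('a option \<times> 'a option \<times> nat) set"
  for P f n where
  orig: "p \<in> Field P \<Longrightarrow> (Some p, Some p, f p) \<in> subdiv_points P f n"
| edge: "covers P p q \<Longrightarrow> f p \<le> j \<Longrightarrow> j < f q \<Longrightarrow> (Some p, Some q, j) \<in> subdiv_points P f n"
| bot: "q \<in> minimal_points P \<Longrightarrow> 1 \<le> j \<Longrightarrow> j < f q \<Longrightarrow> (None, Some q, j) \<in> subdiv_points P f n"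
| top: "p \<in> maximal_points P \<Longrightarrow> f p \<le> j \<Longrightarrow> j \<le> n \<Longrightarrow> (Some p, None, j) \<in> subdiv_points P f n"

text \<open>Points on different edges are compared through their ends alone. An end
  \<open>None\<close> never matches, so two bottom edges, or two top edges, stay incomparable
  although they are written with the same end.\<close>

fun subdiv_le :: "'a rel \<Rightarrow> 'a option \<times> 'a option \<times> nat \<Rightarrow> 'a option \<times> 'a option \<times> nat \<Rightarrow> bool" where
  "subdiv_le P (d, u, j) (d', u', j') \<longleftrightarrow>
    d = d' \<and> u = u' \<and> j \<le> j' \<or> (\<exists>x y. u = Some x \<and> d' = Some y \<and> (x, y) \<in> P)"

definition subdiv :: "'a rel \<Rightarrow> ('a \<Rightarrow> nat) \<Rightarrow> nat \<Rightarrow> ('a option \<times> 'a option \<times> nat) rel" where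
  "subdiv P f n = {(a, b) \<in> subdiv_points P f n \<times> subdiv_points P f n. subdiv_le P a b}"

text \<open>Among the points of the subdivision only the original ones have equal ends; a triple
  with both ends \<open>None\<close> does not occur there, so \<open>the d\<close> is
  meaningful.\<close>

fun subdiv_label :: "'a option \<times> 'a option \<times> nat \<Rightarrow> 'a + nat" where
  "subdiv_label (d, u, j) = (if d = u then Inl (the d) else Inr j)"

text \<open>The end \<open>None\<close> imposes no condition, so the bottom and top edges at points
  of \<open>M\<close> are included.\<close>

definition subdiv_chain :: "'a rel \<Rightarrow> ('a \<Rightarrow> nat) \<Rightarrow> nat \<Rightarrow> 'a set \<Rightarrow> ('a option \<times> 'a option \<times> nat) set" where
  "subdiv_chain P f n M =
    {(d, u, j). (d, u, j) \<in> subdiv_points P f n \<and> set_option d \<subseteq> M \<and> set_option u \<subseteq> M}"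

text \<open>The lift of \<open>weave\<close> from labels to points: \<open>d\<close> remembers the
  lower end of the edge that is being traversed.\<close>

fun subdiv_list :: "('a \<Rightarrow> nat) \<Rightarrow> 'a option \<Rightarrow> nat \<Rightarrow> nat \<Rightarrow> 'a list \<Rightarrow> ('a option \<times> 'a option \<times> nat) list" where
  "subdiv_list f d k m [] = map (\<lambda>j. (d, None, j)) [k..<m]"
| "subdiv_list f d k m (x # xs) =
    map (\<lambda>j. (d, Some x, j)) [k..<f x] @ (Some x, Some x, f x) # subdiv_list f (Some x) (f x) m xs"

text \<open>A walk up the extended Hasse diagram from \<open>d\<close> to the top, one edge at a
  time. This is what puts the points of \<open>subdiv_list\<close> into
  \<open>subdiv_points\<close>.\<close>

fun linked :: "'a rel \<Rightarrow> 'a option \<Rightarrow> 'a list \<Rightarrow> bool" where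
  "linked P d [] \<longleftrightarrow> (\<exists>p\<in>maximal_points P. d = Some p)"
| "linked P d (x # xs) \<longleftrightarrow> x \<in> Field P \<and>
    (case d of None \<Rightarrow> x \<in> minimal_points P | Some p \<Rightarrow> covers P p x) \<and> linked P (Some x) xs"

text \<open>The first two assumptions keep the ends of a proper edge distinct. The last one excludes
  an edge from bottom straight to top, both of whose ends are \<open>None\<close>, so that its
  letters would be labelled as points.\<close>

lemma map_subdiv_label:
  assumes "d \<notin> Some ` set xs" "distinct xs" "d = None \<longrightarrow> xs \<noteq> []"
  shows "map subdiv_label (subdiv_list f d k m xs) = weave f k m xs"
  using assms by (induction xs arbitrary: d k) (auto simp: comp_def)

lemma subdiv_list_fst:
  "b \<in> set (subdiv_list f d k m xs) \<Longrightarrow> fst b = d \<or> fst b \<in> Some ` set xs"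
  by (induction xs arbitrary: d k) auto

lemma subdiv_list_fst_snd:
  "b \<in> set (subdiv_list f d k m xs) \<Longrightarrow> fst (snd b) \<in> insert None (Some ` set xs)"
  by (induction xs arbitrary: d k) auto

lemma distinct_subdiv_list:
  assumes "d \<notin> Some ` set xs" "distinct xs"
  shows "distinct (subdiv_list f d k m xs)"
  using assms
proof (induction xs arbitrary: d k)
  case (Cons x xs)
  let ?T = "subdiv_list f (Some x) (f x) m xs"
  have "distinct ?T" by (rule Cons.IH) (use Cons.prems in auto)
  moreover have "(Some x, Some x, f x) \<notin> set ?T"
    using subdiv_list_fst_snd[of "(Some x, Some x, f x)" f "Some x" "f x" m xs] Cons.prems by auto
  moreover have "(d, Some x, j) \<notin> set ?T" for j
    using subdiv_list_fst[of "(d, Some x, j)" f "Some x" "f x" m xs] Cons.prems by auto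
  ultimately show ?case using Cons.prems by (auto simp: distinct_map inj_on_def)
qed (simp add: distinct_map inj_on_def)

lemma subdiv_list_append:
  "set (subdiv_list f (Some p) (f p) m vs) \<subseteq> set (subdiv_list f d k m (us @ p # vs))"
  by (induction us arbitrary: d k) auto

lemma subdiv_list_subset:
  assumes "linked P d xs" "k = (case d of None \<Rightarrow> 1 | Some p \<Rightarrow> f p)"
  shows "set (subdiv_list f d k (Suc n) xs) \<subseteq> subdiv_points P f n"
  using assms
proof (induction xs arbitrary: d k)
  case (Cons x xs)
  have "set (subdiv_list f (Some x) (f x) (Suc n) xs) \<subseteq> subdiv_points P f n"
    by (rule Cons.IH) (use Cons.prems in auto)
  then show ?case
    using Cons.prems by (cases d) (auto intro: subdiv_points.intros)
qed (auto intro: subdiv_points.intros)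

lemma sorted_subdiv_edge: "sorted_wrt (subdiv_le P) (map (\<lambda>j. (d, u, j)) [k..<m])"
  unfolding sorted_wrt_map by (rule sorted_wrt_mono_rel[OF _ sorted_upt]) simp

lemma sorted_subdiv_list:
  assumes "sorted_wrt (\<lambda>x y. (x, y) \<in> P) xs" "\<And>x. x \<in> set xs \<Longrightarrow> (x, x) \<in> P"
  shows "sorted_wrt (subdiv_le P) (subdiv_list f d k m xs)"
  using assms
proof (induction xs arbitrary: d k)
  case Nil
  show ?case by (simp add: sorted_subdiv_edge)
next
  case (Cons x xs)
  have tail: "subdiv_le P (c, Some x, j) b" if "b \<in> set (subdiv_list f (Some x) (f x) m xs)" for b c j
    using subdiv_list_fst[OF that] Cons.prems by (cases b) auto
  have "sorted_wrt (subdiv_le P) (subdiv_list f (Some x) (f x) m xs)"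
    by (rule Cons.IH) (use Cons.prems in auto)
  then show ?case
    using sorted_subdiv_edge[of P d "Some x" k "f x"] Cons.prems(2)[of x] tail
    by (auto simp: sorted_wrt_append)
qed

section \<open>The subdivided Hasse diagram as a finite poset\<close>

locale weak_map =
  fixes P :: "'a rel" and f :: "'a \<Rightarrow> nat" and n :: nat
  assumes poset: "finite_poset P" and nonempty: "Field P \<noteq> {}" and f: "f \<in> weak_maps P (Suc n)"
begin

lemmas P = finite_posetD[OF poset]
lemmas max_chain = maximal_chains_iff[OF poset]

lemma f_range: "p \<in> Field P \<Longrightarrow> 1 \<le> f p \<and> f p \<le> Suc n"
  and f_mono: "(p, q) \<in> P \<Longrightarrow> f p \<le> f q"
  using f by (auto simp: weak_maps_def)

lemma P_trans: "(x, y) \<in> P \<Longrightarrow> (y, z) \<in> P \<Longrightarrow> (x, z) \<in> P"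
  using P(4) by (blast dest: transD)

lemma P_antisym: "(x, y) \<in> P \<Longrightarrow> (y, x) \<in> P \<Longrightarrow> x = y"
  using P(3) by (blast dest: antisymD)

lemma coversD: "covers P p q \<Longrightarrow> (p, q) \<in> P \<and> p \<in> Field P \<and> q \<in> Field P \<and> p \<noteq> q"
  by (auto simp: covers_def FieldI1 FieldI2)

lemma subdiv_points_Field:
  assumes "(d, u, j) \<in> subdiv_points P f n"
  shows "set_option d \<subseteq> Field P" "set_option u \<subseteq> Field P"
  using assms by (cases; auto dest: coversD simp: minimal_points_def maximal_points_def)+

text \<open>The link through a single point, from its lower to its upper end, on which transitivity
  and antisymmetry of the subdivision rest.\<close>

lemma subdiv_points_le:
  assumes "(Some x, Some y, j) \<in> subdiv_points P f n"
  shows "(x, y) \<in> P"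
  using assms by cases (auto dest: coversD P(5))

lemma finite_subdiv_points: "finite (subdiv_points P f n)"
proof (rule finite_subset)
  let ?F = "insert None (Some ` Field P)"
  show "subdiv_points P f n \<subseteq> ?F \<times> ?F \<times> {..Suc n}"
  proof
    fix a assume "a \<in> subdiv_points P f n"
    moreover obtain d u j where a: "a = (d, u, j)" by (cases a)
    ultimately have pt: "(d, u, j) \<in> subdiv_points P f n" by simp
    then have "j \<le> Suc n"
    proof cases
      case (edge p q)
      then show ?thesis using f_range[of q] coversD[of p q] by auto
    next
      case (bot q)
      then show ?thesis using f_range[of q] by (auto simp: minimal_points_def)
    qed (use f_range in auto)
    moreover have "d \<in> ?F" "u \<in> ?F" using subdiv_points_Field[OF pt] by (cases d; cases u; simp)+
    ultimately show "a \<in> ?F \<times> ?F \<times> {..Suc n}" by (simp add: a)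
  qed
qed (use P(1) in simp)

lemma subdiv_refl: "a \<in> subdiv_points P f n \<Longrightarrow> (a, a) \<in> subdiv P f n"
  by (cases a) (simp add: subdiv_def)

lemma Field_subdiv: "Field (subdiv P f n) = subdiv_points P f n"
  using subdiv_refl by (auto simp: Field_def) (auto simp: subdiv_def)

lemma finite_poset_subdiv: "finite_poset (subdiv P f n)"
proof -
  have sub: "subdiv P f n \<subseteq> subdiv_points P f n \<times> subdiv_points P f n" by (auto simp: subdiv_def)
  then have "finite (subdiv P f n)" using finite_subdiv_points by (meson finite_SigmaI finite_subset)
  moreover have "refl_on (subdiv_points P f n) (subdiv P f n)" using subdiv_refl by (simp add: refl_on_def)
  moreover have "trans (subdiv P f n)"
  proof (rule transI)
    fix a b c assume ab: "(a, b) \<in> subdiv P f n" and bc: "(b, c) \<in> subdiv P f n"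
    obtain d u j where b: "b = (d, u, j)" by (cases b)
    have m: "(x, y) \<in> P" if "d = Some x" "u = Some y" for x y
      using ab that subdiv_points_le by (auto simp: subdiv_def b)
    obtain d1 u1 j1 d2 u2 j2 where a: "a = (d1, u1, j1)" and c: "c = (d2, u2, j2)" by (cases a, cases c)
    have le: "subdiv_le P (d1, u1, j1) (d, u, j)" "subdiv_le P (d, u, j) (d2, u2, j2)"
      using ab bc by (auto simp: subdiv_def a b c)
    \<comment> \<open>A comparison within one edge leaves the ends unchanged; if both comparisons go
      across edges, then \<open>u1\<close>, \<open>d\<close>, \<open>u\<close>, \<open>d2\<close>
      increase in \<open>P\<close>, with \<open>m\<close> as the middle link.\<close>
    show "(a, c) \<in> subdiv P f n"
    proof (cases "d1 = d \<and> u1 = u \<and> j1 \<le> j \<or> d = d2 \<and> u = u2 \<and> j \<le> j2")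
      case True
      then have "subdiv_le P (d1, u1, j1) (d2, u2, j2)" using le by auto
      then show ?thesis using ab bc by (simp add: subdiv_def a c)
    next
      case False
      then obtain x y x' y' where "u1 = Some x" "d = Some y" "(x, y) \<in> P"
          "u = Some x'" "d2 = Some y'" "(x', y') \<in> P"
        using le by auto
      moreover from this have "(x, y') \<in> P" using m P_trans by blast
      ultimately show ?thesis using ab bc by (simp add: subdiv_def a c)
    qed
  qed
  moreover have "antisym (subdiv P f n)"
  proof (rule antisymI)
    fix a b assume ab: "(a, b) \<in> subdiv P f n" and ba: "(b, a) \<in> subdiv P f n"
    obtain d u j d' u' j' where a: "a = (d, u, j)" and b: "b = (d', u', j')" by (cases a, cases b)
    have m: "(x, y) \<in> P" if "d = Some x \<and> u = Some y \<or> d' = Some x \<and> u' = Some y" for x y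
      using ab that subdiv_points_le by (auto simp: subdiv_def a b)
    \<comment> \<open>A degenerate edge carries a single point. If it carried two, the clause across
      edges would put each below the other.\<close>
    have orig: "i = f x" if "(Some x, Some x, i) \<in> subdiv_points P f n" for x i
      using that by cases (auto dest: coversD)
    have pts: "(d, u, j) \<in> subdiv_points P f n" "(d', u', j') \<in> subdiv_points P f n"
      using ab by (auto simp: subdiv_def a b)
    have le: "subdiv_le P (d, u, j) (d', u', j')" "subdiv_le P (d', u', j') (d, u, j)"
      using ab ba by (auto simp: subdiv_def a b)
    show "a = b"
    proof (cases "d = d' \<and> u = u'")
      case True
      show ?thesis
      proof (cases "j = j'")
        case False
        then obtain x y where xy: "u = Some x" "d = Some y" "(x, y) \<in> P" using le True by auto
        then have "x = y" using m P_antisym by blast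
        then show ?thesis using pts True xy orig by (auto simp: a b)
      qed (simp add: a b True)
    next
      case False
      then obtain x y x' y' where xy: "u = Some x" "d' = Some y" "(x, y) \<in> P"
          "u' = Some x'" "d = Some y'" "(x', y') \<in> P"
        using le by auto
      have "(y', x) \<in> P" "(y, x') \<in> P" using m xy by auto
      then have "x = y" "x' = y'" "y' = x" using xy P_trans P_antisym by metis+
      then show ?thesis using False xy by simp
    qed
  qed
  ultimately show ?thesis
    using sub by (simp add: finite_poset_def partial_order_on_def preorder_on_def Field_subdiv)
qed

section \<open>Maximal chains of the subdivision\<close>

lemmas max_chain_subdiv = maximal_chains_iff[OF finite_poset_subdiv, unfolded Field_subdiv]

abbreviation orig :: "'a \<Rightarrow> 'a option \<times> 'a option \<times> nat" where
  "orig p \<equiv> (Some p, Some p, f p)"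

text \<open>An original point is both ends of its own edge, so by reflexivity the clause for a
  common edge is absorbed by the clause across edges.\<close>

lemma subdiv_orig_iff:
  assumes "(d, u, j) \<in> subdiv_points P f n" "p \<in> Field P"
  shows "((d, u, j), orig p) \<in> subdiv P f n \<longleftrightarrow> (\<exists>x. u = Some x \<and> (x, p) \<in> P)"
    "(orig p, (d, u, j)) \<in> subdiv P f n \<longleftrightarrow> (\<exists>x. d = Some x \<and> (p, x) \<in> P)"
  using assms P(5) by (auto simp: subdiv_def subdiv_points.orig)

lemma orig_subdiv_iff:
  "p \<in> Field P \<Longrightarrow> q \<in> Field P \<Longrightarrow> (orig p, orig q) \<in> subdiv P f n \<longleftrightarrow> (p, q) \<in> P"
  by (simp add: subdiv_orig_iff subdiv_points.orig)

lemma maximal_chain_nonempty: "M \<in> maximal_chains P \<Longrightarrow> M \<noteq> {}"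
  using nonempty by (auto simp: max_chain)

text \<open>Maximality forbids gaps: an element below the first, between two consecutive, or above
  the last entry is comparable with all of \<open>M\<close> and thus belongs to it. The prefix
  \<open>us\<close> stays in the statement because maximality concerns the whole chain and not its
  remainder.\<close>

lemma linked_chain_list:
  assumes M: "M \<in> maximal_chains P" and "chain_list P M = us @ xs"
  shows "linked P (if us = [] then None else Some (last us)) xs"
  using assms(2)
proof (induction xs arbitrary: us)
  case Nil
  note cl = chain_list[OF poset M]
  have us: "us \<noteq> []" "set us = M" using Nil cl(2) maximal_chain_nonempty[OF M] by auto
  then obtain vs p where vs: "us = vs @ [p]" by (metis rev_exhaust)
  have le: "(x, p) \<in> P" if "x \<in> M" for x
    using that cl(3) us P(5) M by (auto simp: Nil vs sorted_wrt_append max_chain)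
  have pM: "p \<in> M" using us vs by auto
  have "y = p" if "(p, y) \<in> P" for y
  proof -
    have "y \<in> M" using M le that P_trans FieldI2[OF that] unfolding max_chain by blast
    then show ?thesis using le that P_antisym by blast
  qed
  then have "p \<in> maximal_points P" using pM M by (auto simp: maximal_points_def max_chain)
  then show ?case by (simp add: vs)
next
  case (Cons x xs)
  note cl = chain_list[OF poset M]
  have setM: "M = set us \<union> {x} \<union> set xs" using cl(2) by (auto simp: Cons.prems)
  have xF: "x \<in> Field P" using M setM by (auto simp: max_chain)
  have above: "(x, y) \<in> P" if "y \<in> {x} \<union> set xs" for y
    using that cl(3) P(5)[OF xF] by (auto simp: Cons.prems sorted_wrt_append)
  have "linked P (Some x) xs" using Cons.IH[of "us @ [x]"] Cons.prems by simp
  moreover have "x \<in> minimal_points P" if us: "us = []"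
  proof -
    have "y = x" if y: "(y, x) \<in> P" for y
    proof -
      have ge: "(x, z) \<in> P" if "z \<in> M" for z using that above setM us by auto
      then have "y \<in> M" using M y P_trans FieldI1[OF y] unfolding max_chain by blast
      then show ?thesis using ge y P_antisym by blast
    qed
    then show ?thesis using xF by (auto simp: minimal_points_def)
  qed
  moreover have "covers P p x" if us: "us = vs @ [p]" for vs p
  proof -
    have p: "(p, x) \<in> P" "p \<noteq> x" "p \<in> Field P"
      using cl M by (auto simp: Cons.prems us sorted_wrt_append max_chain)
    have below: "(y, p) \<in> P" if "y \<in> set us" for y
      using that cl(3) P(5)[OF p(3)] by (auto simp: Cons.prems us sorted_wrt_append)
    have "r = p \<or> r = x" if r: "(p, r) \<in> P" "(r, x) \<in> P" for r
    proof -
      have "(y, r) \<in> P \<or> (r, y) \<in> P" if y: "y \<in> M" for y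
      proof (cases "y \<in> set us")
        case True
        then show ?thesis using P_trans[OF below r(1)] by blast
      next
        case False
        then show ?thesis using P_trans[OF r(2) above] y setM by blast
      qed
      then have "r \<in> M" using M FieldI2[OF r(1)] unfolding max_chain by blast
      then consider "r \<in> set us" | "r \<in> {x} \<union> set xs" using setM by blast
      then show ?thesis
        by cases (use P_antisym[OF below r(1)] P_antisym[OF r(2) above] in blast)+
    qed
    then show ?thesis using p by (auto simp: covers_def)
  qed
  ultimately show ?case using xF by (cases us rule: rev_cases) auto
qed

text \<open>For the harder inclusion, an edge with both ends in \<open>M\<close> must join
  consecutive entries of the chain, since nothing lies strictly between its ends; likewise a bottom
  edge can only lead to the first entry, and a top edge only start at the last one.\<close>

lemma set_subdiv_list:
  assumes M: "M \<in> maximal_chains P"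
  shows "set (subdiv_list f None 1 (Suc n) (chain_list P M)) = subdiv_chain P f n M"
proof (intro equalityI subsetI)
  note cl = chain_list[OF poset M]
  let ?L = "subdiv_list f None 1 (Suc n) (chain_list P M)"
  fix a assume a: "a \<in> set ?L"
  have "linked P None (chain_list P M)" using linked_chain_list[OF M, of "[]"] by simp
  then have "a \<in> subdiv_points P f n" using a subdiv_list_subset by fastforce
  then show "a \<in> subdiv_chain P f n M"
    using subdiv_list_fst[OF a] subdiv_list_fst_snd[OF a] cl(2)
    by (cases a) (auto simp: subdiv_chain_def)
next
  note cl = chain_list[OF poset M]
  let ?L = "subdiv_list f None 1 (Suc n) (chain_list P M)"
  fix a assume "a \<in> subdiv_chain P f n M"
  then obtain d u j where a: "a = (d, u, j)" and pt: "(d, u, j) \<in> subdiv_points P f n"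
    and sub: "set_option d \<subseteq> M" "set_option u \<subseteq> M" by (auto simp: subdiv_chain_def)
  from pt show "a \<in> set ?L"
  proof cases
    case (orig p)
    then obtain us vs where uv: "chain_list P M = us @ p # vs"
      using sub cl(2) by (metis option.set_intros split_list subsetD)
    have "orig p \<in> set (subdiv_list f c k m (us @ p # vs))" for c k m
      by (induction us arbitrary: c k) auto
    then show ?thesis using orig by (simp add: a uv)
  next
    case (edge p q)
    then have pq: "p \<in> M" "q \<in> M" using sub by auto
    then obtain us vs where uv: "chain_list P M = us @ p # vs" using cl(2) by (metis split_list)
    have "(p, q) \<in> P" "p \<noteq> q" using coversD edge by blast+
    moreover have "(y, p) \<in> P" if "y \<in> set us" for y
      using cl(3) that by (simp add: uv sorted_wrt_append)
    ultimately have "q \<notin> set (us @ [p])" using P_antisym by auto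
    then have q: "q \<in> set vs" using pq(2) cl(2) by (auto simp: uv)
    then obtain v ws where vs: "vs = v # ws" by (cases vs) auto
    have "(p, v) \<in> P" "(v, q) \<in> P" "v \<noteq> p"
      using cl q P(5) M by (auto simp: uv vs sorted_wrt_append max_chain)
    then have "v = q" using edge(3) by (auto simp: covers_def)
    then show ?thesis
      using subdiv_list_append[of f p "Suc n" vs None 1 us] edge by (auto simp: a uv vs)
  next
    case (bot q)
    then obtain x xs where xs: "chain_list P M = x # xs" using sub cl(2) by (cases "chain_list P M") auto
    have "(x, q) \<in> P" using cl sub bot P(5) M by (auto simp: xs max_chain)
    then have "x = q" using bot by (auto simp: minimal_points_def)
    then show ?thesis using bot by (simp add: a xs)
  next
    case (top p)
    then obtain us vs where uv: "chain_list P M = us @ p # vs"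
      using sub cl(2) by (metis option.set_intros split_list subsetD)
    have "vs = []" using cl(1,3) top by (cases vs) (auto simp: uv maximal_points_def sorted_wrt_append)
    then have "a \<in> set (subdiv_list f (Some p) (f p) (Suc n) vs)"
      using top by (auto simp: a simp del: upt_Suc)
    then show ?thesis using subdiv_list_append unfolding uv by fast
  qed
qed

lemma sorted_distinct_subdiv_chain:
  assumes M: "M \<in> maximal_chains P"
  defines "L \<equiv> subdiv_list f None 1 (Suc n) (chain_list P M)"
  shows "distinct L" "sorted_wrt (\<lambda>a b. (a, b) \<in> subdiv P f n) L"
proof -
  note cl = chain_list[OF poset M]
  show "distinct L" unfolding L_def by (rule distinct_subdiv_list) (use cl in auto)
  have "sorted_wrt (subdiv_le P) L"
    unfolding L_def by (rule sorted_subdiv_list[OF cl(3)]) (use cl(2) P(5) M in \<open>auto simp: max_chain\<close>)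
  moreover have "set L \<subseteq> subdiv_points P f n"
    unfolding L_def set_subdiv_list[OF M] by (auto simp: subdiv_chain_def)
  ultimately show "sorted_wrt (\<lambda>a b. (a, b) \<in> subdiv P f n) L"
    by (auto simp: subdiv_def elim!: sorted_wrt_mono_rel[rotated])
qed

lemma subdiv_chain_total:
  assumes M: "M \<in> maximal_chains P" and ab: "a \<in> subdiv_chain P f n M" "b \<in> subdiv_chain P f n M"
  shows "(a, b) \<in> subdiv P f n \<or> (b, a) \<in> subdiv P f n"
proof -
  let ?L = "subdiv_list f None 1 (Suc n) (chain_list P M)"
  obtain i j where ij: "i < length ?L" "j < length ?L" "a = ?L ! i" "b = ?L ! j"
    using ab unfolding set_subdiv_list[OF M, symmetric] in_set_conv_nth by blast
  have "ab' \<in> subdiv P f n" if "ab' = (?L ! k, ?L ! l)" "k < l" "l < length ?L" for ab' k l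
    using sorted_wrt_nth_less[OF sorted_distinct_subdiv_chain(2)[OF M] that(2,3)] that(1) by simp
  moreover have "(a, a) \<in> subdiv P f n" using ab(1) by (auto simp: subdiv_chain_def intro: subdiv_refl)
  ultimately show ?thesis using ij by (cases i j rule: linorder_cases) auto
qed

lemma orig_in_subdiv_chain:
  "M \<in> maximal_chains P \<Longrightarrow> p \<in> Field P \<Longrightarrow> orig p \<in> subdiv_chain P f n M \<longleftrightarrow> p \<in> M"
  by (auto simp: subdiv_chain_def subdiv_points.orig)

text \<open>If a point is comparable with the original points of \<open>M\<close>, then each of its
  ends in \<open>P\<close> is comparable with all of \<open>M\<close>, hence lies in
  \<open>M\<close> by maximality.\<close>

lemma maximal_chain_subdiv_chain:
  assumes M: "M \<in> maximal_chains P"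
  shows "subdiv_chain P f n M \<in> maximal_chains (subdiv P f n)"
  unfolding max_chain_subdiv
proof (intro conjI ballI impI)
  show "subdiv_chain P f n M \<subseteq> subdiv_points P f n" by (auto simp: subdiv_chain_def)
next
  fix a assume pt: "a \<in> subdiv_points P f n"
    and cmp: "\<forall>b\<in>subdiv_chain P f n M. (b, a) \<in> subdiv P f n \<or> (a, b) \<in> subdiv P f n"
  obtain d u j where a: "a = (d, u, j)" by (cases a)
  note pt' = pt[unfolded a]
  have cmp_orig: "(\<exists>x. u = Some x \<and> (x, p) \<in> P) \<or> (\<exists>x. d = Some x \<and> (p, x) \<in> P)" if "p \<in> M" for p
  proof -
    have "p \<in> Field P" using M that by (auto simp: max_chain)
    then show ?thesis
      using cmp orig_in_subdiv_chain[OF M, of p] that subdiv_orig_iff[OF pt', of p] unfolding a by blast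
  qed
  have "d = Some x \<Longrightarrow> x \<in> M" "u = Some x \<Longrightarrow> x \<in> M" for x
  proof -
    have le: "(y, z) \<in> P" if "d = Some y" "u = Some z" for y z using subdiv_points_le pt' that by blast
    have F: "d = Some y \<Longrightarrow> y \<in> Field P" "u = Some y \<Longrightarrow> y \<in> Field P" for y
      using subdiv_points_Field[OF pt'] by auto
    show "x \<in> M" if x: "d = Some x"
    proof -
      have "(p, x) \<in> P \<or> (x, p) \<in> P" if "p \<in> M" for p
        using cmp_orig[OF that] x le P_trans by blast
      then show ?thesis using M F(1)[OF x] unfolding max_chain by blast
    qed
    show "x \<in> M" if x: "u = Some x"
    proof -
      have "(p, x) \<in> P \<or> (x, p) \<in> P" if "p \<in> M" for p
        using cmp_orig[OF that] x le P_trans by blast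
      then show ?thesis using M F(2)[OF x] unfolding max_chain by blast
    qed
  qed
  then show "a \<in> subdiv_chain P f n M" using pt by (auto simp: subdiv_chain_def a)
qed (rule subdiv_chain_total[OF M])

text \<open>The original points of \<open>C\<close> form a chain of \<open>P\<close>, which is
  extended to a maximal chain \<open>M\<close>. Whenever \<open>C\<close> meets an edge, the ends of
  that edge are comparable with all of \<open>C\<close> and so belong to it; therefore
  \<open>C\<close> lies in the chain of \<open>M\<close>, and maximality of \<open>C\<close> gives
  equality.\<close>

lemma maximal_chain_subdivE:
  assumes C: "C \<in> maximal_chains (subdiv P f n)"
  obtains M where "M \<in> maximal_chains P" "C = subdiv_chain P f n M"
proof -
  note C' = C[unfolded max_chain_subdiv]
  define D where "D = {p \<in> Field P. orig p \<in> C}"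
  have "\<forall>p\<in>D. \<forall>q\<in>D. (p, q) \<in> P \<or> (q, p) \<in> P"
    using C' orig_subdiv_iff unfolding D_def by blast
  then obtain M where M: "M \<in> maximal_chains P" "D \<subseteq> M"
    using ex_maximal_chain[OF poset, of D] by (auto simp: D_def)
  have in_D: "x \<in> D" if a: "(d, u, j) \<in> C" and x: "d = Some x \<or> u = Some x" for d u j x
  proof -
    have pt: "(d, u, j) \<in> subdiv_points P f n" using a C' by blast
    have xF: "x \<in> Field P" using subdiv_points_Field[OF pt] x by auto
    have "(b, orig x) \<in> subdiv P f n \<or> (orig x, b) \<in> subdiv P f n" if b: "b \<in> C" for b
    proof -
      obtain d' u' j' where b': "b = (d', u', j')" by (cases b)
      have ptb: "(d', u', j') \<in> subdiv_points P f n" using b C' by (auto simp: b')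
      have le: "(y, z) \<in> P" if "d = Some y \<and> u = Some z \<or> d' = Some y \<and> u' = Some z" for y z
        using subdiv_points_le pt ptb that by blast
      have "((d, u, j), b) \<in> subdiv P f n \<or> (b, (d, u, j)) \<in> subdiv P f n" using C' a b by blast
      then consider "d' = d" "u' = u" | y z where "u = Some y" "d' = Some z" "(y, z) \<in> P"
        | y z where "u' = Some y" "d = Some z" "(y, z) \<in> P"
        by (auto simp: subdiv_def b')
      then show ?thesis
        unfolding b' subdiv_orig_iff[OF ptb xF]
      proof cases
        case 1 then show "(\<exists>y. u' = Some y \<and> (y, x) \<in> P) \<or> (\<exists>y. d' = Some y \<and> (x, y) \<in> P)"
          using x P(5)[OF xF] by blast
      next
        case (2 y z)
        then have "(x, z) \<in> P" using x le[of x y] P_trans by auto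
        then show "(\<exists>y. u' = Some y \<and> (y, x) \<in> P) \<or> (\<exists>y. d' = Some y \<and> (x, y) \<in> P)" using 2 by blast
      next
        case (3 y z)
        then have "(y, x) \<in> P" using x le[of z x] P_trans by auto
        then show "(\<exists>y. u' = Some y \<and> (y, x) \<in> P) \<or> (\<exists>y. d' = Some y \<and> (x, y) \<in> P)" using 3 by blast
      qed
    qed
    then have "orig x \<in> C" using C' subdiv_points.orig[OF xF] by blast
    then show ?thesis using xF by (simp add: D_def)
  qed
  have sub: "C \<subseteq> subdiv_chain P f n M"
  proof
    fix a assume a: "a \<in> C"
    obtain d u j where a': "a = (d, u, j)" by (cases a)
    show "a \<in> subdiv_chain P f n M"
      using a C' in_D[OF a[unfolded a']] M(2) unfolding a' subdiv_chain_def elem_set by blast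
  qed
  have "subdiv_chain P f n M \<subseteq> C"
  proof
    fix a assume a: "a \<in> subdiv_chain P f n M"
    then have "\<forall>b\<in>C. (b, a) \<in> subdiv P f n \<or> (a, b) \<in> subdiv P f n"
      using sub subdiv_chain_total[OF M(1)] by blast
    moreover have "a \<in> subdiv_points P f n" using a by (auto simp: subdiv_chain_def)
    ultimately show "a \<in> C" using C' by blast
  qed
  with sub have "C = subdiv_chain P f n M" by (rule equalityI)
  then show ?thesis using that M(1) by metis
qed

lemma bij_subdiv_chain:
  "bij_betw (subdiv_chain P f n) (maximal_chains P) (maximal_chains (subdiv P f n))"
proof (rule bij_betwI')
  fix M N assume M: "M \<in> maximal_chains P" and N: "N \<in> maximal_chains P"
  show "subdiv_chain P f n M = subdiv_chain P f n N \<longleftrightarrow> M = N"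
  proof
    have sub: "M \<subseteq> Field P" "N \<subseteq> Field P" using M N by (simp_all add: max_chain)
    assume eq: "subdiv_chain P f n M = subdiv_chain P f n N"
    have "p \<in> M \<longleftrightarrow> p \<in> N" if "p \<in> Field P" for p
      using orig_in_subdiv_chain[OF M that] orig_in_subdiv_chain[OF N that] unfolding eq by simp
    then show "M = N" using sub by blast
  qed simp
next
  show "\<exists>M\<in>maximal_chains P. C = subdiv_chain P f n M" if "C \<in> maximal_chains (subdiv P f n)" for C
    using maximal_chain_subdivE[OF that] by metis
qed (rule maximal_chain_subdiv_chain)

text \<open>The upper end is a bijection onto the minimal points of \<open>P\<close>: a minimal
  point of the subdivision is some minimal \<open>q\<close> itself or lies on the bottom edge of
  \<open>q\<close>, and two of them with the same upper end are comparable, hence equal.\<close>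

lemma card_minimal_points_subdiv: "card (minimal_points (subdiv P f n)) = card (minimal_points P)"
proof -
  let ?m = "minimal_points (subdiv P f n)"
  have up: "\<exists>q\<in>minimal_points P. u = Some q \<and> (d = None \<or> (d, u, j) = orig q)"
    if a: "(d, u, j) \<in> ?m" for d u j
  proof (cases d)
    case None
    have "(d, u, j) \<in> subdiv_points P f n" using a by (simp add: minimal_points_def Field_subdiv)
    then show ?thesis by cases (auto simp: None)
  next
    case (Some y)
    have pt: "(d, u, j) \<in> subdiv_points P f n" using a by (simp add: minimal_points_def Field_subdiv)
    have y: "y \<in> Field P" using subdiv_points_Field[OF pt] Some by simp
    \<comment> \<open>With a lower end \<open>y\<close> in \<open>P\<close>, the original point of
      \<open>y\<close> lies below, so minimality leaves only this point.\<close>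
    have "(orig y, (d, u, j)) \<in> subdiv P f n"
      using subdiv_orig_iff(2)[OF pt y] Some P(5)[OF y] by simp
    then have eq: "(d, u, j) = orig y" using a by (auto simp: minimal_points_def)
    have "z = y" if z: "(z, y) \<in> P" for z
      using orig_subdiv_iff[OF FieldI1[OF z] y] z a unfolding eq by (auto simp: minimal_points_def)
    then show ?thesis using y eq by (auto simp: minimal_points_def)
  qed
  have "inj_on (\<lambda>(d, u, j). u) ?m"
  proof (rule inj_onI)
    fix a b assume ab: "a \<in> ?m" "b \<in> ?m" "(case a of (d, u, j) \<Rightarrow> u) = (case b of (d, u, j) \<Rightarrow> u)"
    then obtain d j d' u j' where ab': "a = (d, u, j)" "b = (d', u, j')" by (cases a, cases b) auto
    note a = ab(1,2)[unfolded ab']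
    have "((d, u, j), (d', u, j')) \<in> subdiv P f n \<or> ((d', u, j'), (d, u, j)) \<in> subdiv P f n"
    proof -
      have pt: "(d, u, j) \<in> subdiv_points P f n" "(d', u, j') \<in> subdiv_points P f n"
        using a by (auto simp: minimal_points_def Field_subdiv)
      obtain q where q: "q \<in> minimal_points P" "u = Some q"
        "d = None \<or> (d, u, j) = orig q" "d' = None \<or> (d', u, j') = orig q"
        using up[OF a(1)] up[OF a(2)] by auto
      have "(q, q) \<in> P" using q(1) P(5) by (auto simp: minimal_points_def)
      then show ?thesis using q pt by (auto simp: subdiv_def)
    qed
    then show "a = b" using a unfolding minimal_points_def ab' by blast
  qed
  moreover have "(\<lambda>(d, u, j). u) ` ?m = Some ` minimal_points P"
  proof (intro equalityI subsetI)
    fix u assume "u \<in> Some ` minimal_points P"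
    then obtain q where q: "q \<in> minimal_points P" "u = Some q" by blast
    then have qF: "q \<in> Field P" by (simp add: minimal_points_def)
    obtain d u' j where a: "(d, u', j) \<in> ?m" "((d, u', j), orig q) \<in> subdiv P f n"
      using ex_minimal_point[OF finite_poset_subdiv, of "orig q"] subdiv_points.orig[OF qF]
      by (metis Field_subdiv prod_cases3)
    then have "(d, u', j) \<in> subdiv_points P f n" by (simp add: subdiv_def)
    then obtain x where "u' = Some x" "(x, q) \<in> P" using subdiv_orig_iff(1)[OF _ qF] a(2) by blast
    then have "u' = u" using q by (simp add: minimal_points_def)
    then show "u \<in> (\<lambda>(d, u, j). u) ` ?m" using a(1) by force
  qed (use up in fastforce)
  ultimately show ?thesis by (metis card_image inj_Some)
qed

text \<open>The dual argument: here the lower end identifies the maximal point of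
  \<open>P\<close>.\<close>

lemma card_maximal_points_subdiv: "card (maximal_points (subdiv P f n)) = card (maximal_points P)"
proof -
  let ?m = "maximal_points (subdiv P f n)"
  have down: "\<exists>p\<in>maximal_points P. d = Some p \<and> (u = None \<or> (d, u, j) = orig p)"
    if a: "(d, u, j) \<in> ?m" for d u j
  proof (cases u)
    case None
    have "(d, u, j) \<in> subdiv_points P f n" using a by (simp add: maximal_points_def Field_subdiv)
    then show ?thesis by cases (auto simp: None)
  next
    case (Some y)
    have pt: "(d, u, j) \<in> subdiv_points P f n" using a by (simp add: maximal_points_def Field_subdiv)
    have y: "y \<in> Field P" using subdiv_points_Field[OF pt] Some by simp
    have "((d, u, j), orig y) \<in> subdiv P f n"
      using subdiv_orig_iff(1)[OF pt y] Some P(5)[OF y] by simp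
    then have eq: "(d, u, j) = orig y" using a by (auto simp: maximal_points_def)
    have "z = y" if z: "(y, z) \<in> P" for z
      using orig_subdiv_iff[OF y FieldI2[OF z]] z a unfolding eq by (auto simp: maximal_points_def)
    then show ?thesis using y eq by (auto simp: maximal_points_def)
  qed
  have "inj_on fst ?m"
  proof (rule inj_onI)
    fix a b assume ab: "a \<in> ?m" "b \<in> ?m" "fst a = fst b"
    obtain d u j d' u' j' where ab': "a = (d, u, j)" "b = (d', u', j')" by (cases a, cases b)
    note a = ab(1,2)[unfolded ab']
    have dd: "d' = d" using ab(3) by (simp add: ab')
    have "((d, u, j), (d', u', j')) \<in> subdiv P f n \<or> ((d', u', j'), (d, u, j)) \<in> subdiv P f n"
    proof -
      have pt: "(d, u, j) \<in> subdiv_points P f n" "(d', u', j') \<in> subdiv_points P f n"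
        using a by (auto simp: maximal_points_def Field_subdiv)
      obtain q where q: "q \<in> maximal_points P" "d = Some q"
        "u = None \<or> (d, u, j) = orig q" "u' = None \<or> (d', u', j') = orig q"
        using down[OF a(1)] down[OF a(2)] dd by auto
      have "(q, q) \<in> P" using q(1) P(5) by (auto simp: maximal_points_def)
      then show ?thesis using q pt dd by (auto simp: subdiv_def)
    qed
    then show "a = b" using a unfolding maximal_points_def ab' by blast
  qed
  moreover have "fst ` ?m = Some ` maximal_points P"
  proof (intro equalityI subsetI)
    fix d assume "d \<in> Some ` maximal_points P"
    then obtain q where q: "q \<in> maximal_points P" "d = Some q" by blast
    then have qF: "q \<in> Field P" by (simp add: maximal_points_def)
    obtain d' u j where a: "(d', u, j) \<in> ?m" "(orig q, (d', u, j)) \<in> subdiv P f n"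
      using ex_maximal_point[OF finite_poset_subdiv, of "orig q"] subdiv_points.orig[OF qF]
      by (metis Field_subdiv prod_cases3)
    then have "(d', u, j) \<in> subdiv_points P f n" by (simp add: subdiv_def)
    then obtain x where "d' = Some x" "(q, x) \<in> P" using subdiv_orig_iff(2)[OF _ qF] a(2) by blast
    then have "d' = d" using q by (simp add: maximal_points_def)
    then show "d \<in> fst ` ?m" using a(1) by force
  qed (use down in fastforce)
  ultimately show ?thesis by (metis card_image inj_Some)
qed

lemma ex_shuffle:
  obtains s where "is_shuffle P n s"
    "\<And>M. M \<in> maximal_chains P \<Longrightarrow> label_sequence s M = weave f 1 (Suc n) (chain_list P M)"
proof -
  let ?A = "subdiv P f n" and ?X = "subdiv_points P f n"
  obtain e :: "'a option \<times> 'a option \<times> nat \<Rightarrow> nat" where e: "inj_on e ?X"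
    using finite_imp_inj_to_nat_seg[OF finite_subdiv_points] by blast
  define s where "s = (dir_image ?A e, subdiv_label \<circ> inv_into ?X e, (`) e \<circ> subdiv_chain P f n)"
  have eA: "inj_on e (Field ?A)" using e by (simp add: Field_subdiv)
  have inv: "(subdiv_label \<circ> inv_into ?X e) (e a) = subdiv_label a" if "a \<in> ?X" for a
    using that e by (simp add: inv_into_f_f)
  have seq: "label_sequence s M = weave f 1 (Suc n) (chain_list P M)" if M: "M \<in> maximal_chains P" for M
  proof -
    let ?L = "subdiv_list f None 1 (Suc n) (chain_list P M)"
    have C: "subdiv_chain P f n M \<in> maximal_chains ?A" by (rule maximal_chain_subdiv_chain[OF M])
    have "chain_list ?A (subdiv_chain P f n M) = ?L"
      using sorted_distinct_subdiv_chain[OF M] set_subdiv_list[OF M]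
      by (intro chain_list_eqI[OF finite_poset_subdiv C]) auto
    then have "label_sequence s M = map (subdiv_label \<circ> inv_into ?X e) (map e ?L)"
      by (simp add: s_def label_sequence_def chain_list_dir_image[OF finite_poset_subdiv eA C])
    also have "\<dots> = map subdiv_label ?L"
      unfolding map_map by (rule map_cong[OF refl])
        (use inv set_subdiv_list[OF M] in \<open>auto simp: subdiv_chain_def\<close>)
    also have "\<dots> = weave f 1 (Suc n) (chain_list P M)"
      using chain_list[OF poset M] maximal_chain_nonempty[OF M] by (intro map_subdiv_label) auto
    finally show ?thesis .
  qed
  have "subdiv_label (d, u, j) \<in> Field P <+> {1..n}" if "(d, u, j) \<in> ?X" for d u j
    using that
  proof cases
    case (edge p q)
    then show ?thesis using f_range[of p] f_range[of q] coversD[of p q] by auto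
  next
    case (bot q)
    then show ?thesis using f_range[of q] by (auto simp: minimal_points_def)
  next
    case (top p)
    then show ?thesis using f_range[of p] by (auto simp: maximal_points_def)
  qed auto
  then have lab: "subdiv_label a \<in> Field P <+> {1..n}" if "a \<in> ?X" for a
    using that by (cases a) blast
  have "subdiv_label (d, u, j) = Inl p \<longleftrightarrow> (d, u, j) = orig p" if "(d, u, j) \<in> ?X" for d u j p
    using that by cases (auto dest: coversD)
  then have lab_orig: "subdiv_label a = Inl p \<longleftrightarrow> a = orig p" if "a \<in> ?X" for a p
    using that by (cases a) blast
  have "\<exists>!b. b \<in> e ` ?X \<and> (subdiv_label \<circ> inv_into ?X e) b = Inl p" if p: "p \<in> Field P" for p
  proof (rule ex1I[of _ "e (orig p)"])
    show "e (orig p) \<in> e ` ?X \<and> (subdiv_label \<circ> inv_into ?X e) (e (orig p)) = Inl p"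
      using subdiv_points.orig[OF p] inv by auto
  next
    fix b assume "b \<in> e ` ?X \<and> (subdiv_label \<circ> inv_into ?X e) b = Inl p"
    then obtain a where "a \<in> ?X" "b = e a" "subdiv_label a = Inl p" using inv by auto
    then show "b = e (orig p)" using lab_orig by simp
  qed
  moreover have "bij_betw ((`) e \<circ> subdiv_chain P f n) (maximal_chains P) (maximal_chains (dir_image ?A e))"
  proof (rule bij_betw_trans[OF bij_subdiv_chain])
    show "bij_betw ((`) e) (maximal_chains ?A) (maximal_chains (dir_image ?A e))"
      unfolding maximal_chains_dir_image[OF finite_poset_subdiv eA]
      by (intro inj_on_imp_bij_betw inj_on_subset[OF inj_on_image_Pow[OF e]]) (auto simp: max_chain_subdiv)
  qed
  moreover have "card (minimal_points (dir_image ?A e)) = card (minimal_points P)"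
    unfolding minimal_points_dir_image[OF eA] card_minimal_points_subdiv[symmetric]
    by (rule card_image, rule inj_on_subset[OF eA]) (auto simp: minimal_points_def)
  moreover have "card (maximal_points (dir_image ?A e)) = card (maximal_points P)"
    unfolding maximal_points_dir_image[OF eA] card_maximal_points_subdiv[symmetric]
    by (rule card_image, rule inj_on_subset[OF eA]) (auto simp: maximal_points_def)
  moreover have "label_sequence s M \<in> shuffles (map Inl (chain_list P M))
      (map Inr (chain_list (chain_poset n) {1..n}))" if M: "M \<in> maximal_chains P" for M
  proof -
    note cl = chain_list[OF poset M]
    have "sorted (map f (chain_list P M))"
      unfolding sorted_map by (rule sorted_wrt_mono_rel[OF _ cl(3)]) (rule f_mono)
    moreover have "1 \<le> f x \<and> f x \<le> Suc n" if "x \<in> set (chain_list P M)" for x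
      using that cl(2) M f_range by (auto simp: max_chain)
    ultimately show ?thesis
      unfolding seq[OF M] chain_list_chain_poset by (rule weave_in_shuffles)
  qed
  ultimately have "is_shuffle P n s"
    unfolding is_shuffle_def s_def using finite_poset_dir_image[OF finite_poset_subdiv eA] lab inv
    by (simp add: dir_image_Field Field_subdiv image_subset_iff)
  then show ?thesis using that seq by blast
qed

end

section \<open>Counting shuffles\<close>

text \<open>The classes are the fibres of \<open>g\<close>. Renaming its points gives a shuffle
  infinitely many representatives, so shuffles are counted by their values under
  \<open>g\<close>.\<close>

lemma card_quotient_kernel:
  "card (S // {(s, t). s \<in> S \<and> t \<in> S \<and> g s = g t}) = card (g ` S)"
proof -
  let ?r = "{(s, t). s \<in> S \<and> t \<in> S \<and> g s = g t}"
  have cls: "?r `` {s} = {t \<in> S. g t = g s}" if "s \<in> S" for s using that by auto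
  have "bij_betw (\<lambda>y. {t \<in> S. g t = y}) (g ` S) (S // ?r)"
  proof (rule bij_betwI')
    show "{t \<in> S. g t = x} = {t \<in> S. g t = y} \<longleftrightarrow> x = y" if "x \<in> g ` S" "y \<in> g ` S" for x y
      using that by blast
    show "{t \<in> S. g t = x} \<in> S // ?r" if x: "x \<in> g ` S" for x
    proof -
      obtain s where "s \<in> S" "x = g s" using x by blast
      then show ?thesis using cls quotientI[of s S ?r] by simp
    qed
    show "\<exists>x\<in>g ` S. C = {t \<in> S. g t = x}" if C: "C \<in> S // ?r" for C
    proof -
      obtain s where "s \<in> S" "C = ?r `` {s}" using C by (rule quotientE)
      then show ?thesis using cls by auto
    qed
  qed
  then show ?thesis by (rule bij_betw_same_card[symmetric])
qed

text \<open>Every \<open>p\<close> lies on some maximal chain, and the number of letters before it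
  there determines the value at \<open>p\<close>.\<close>

lemma weave_inj:
  assumes P: "finite_poset P" and f: "f \<in> weak_maps P (Suc n)" and g: "g \<in> weak_maps P (Suc n)"
    and eq: "\<And>M. M \<in> maximal_chains P \<Longrightarrow>
      weave f 1 (Suc n) (chain_list P M) = weave g 1 (Suc n) (chain_list P M)"
  shows "f = g"
proof (rule PiE_ext)
  show "f \<in> Field P \<rightarrow>\<^sub>E {1..Suc n}" "g \<in> Field P \<rightarrow>\<^sub>E {1..Suc n}"
    using f g by (auto simp: weak_maps_def)
  fix p assume "p \<in> Field P"
  then obtain M where M: "M \<in> maximal_chains P" "p \<in> M"
    using ex_maximal_chain_pair[OF P finite_posetD(5)[OF P]] by metis
  note cl = chain_list[OF P M(1)]
  have "1 + letters_before (weave h 1 (Suc n) (chain_list P M)) p = h p" if h: "h \<in> weak_maps P (Suc n)" for h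
  proof (rule letters_before_weave)
    show "sorted (map h (chain_list P M))"
      unfolding sorted_map by (rule sorted_wrt_mono_rel[OF _ cl(3)]) (use h in \<open>simp add: weak_maps_def\<close>)
    show "1 \<le> h x" if "x \<in> set (chain_list P M)" for x
    proof -
      have "x \<in> Field P" using that cl(2) M(1) by (auto simp: maximal_chains_iff[OF P])
      then show ?thesis using h by (auto simp: weak_maps_def)
    qed
  qed (use cl M in auto)
  then show "f p = g p" using f g eq[OF M(1)] by metis
qed

lemma card_hom_Shuffle:
  assumes P: "finite_poset P" "Field P \<noteq> {}"
  shows "card (hom_Shuffle P n) = card (weak_maps P (Suc n))"
proof -
  define S where "S = {s. is_shuffle P n s}"
  \<comment> \<open>The restriction makes two values equal exactly if the label sequences agree on
    all maximal chains, so \<open>shuffle_equiv\<close> becomes the kernel of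
    \<open>g\<close>.\<close>
  define g where "g = (\<lambda>s. \<lambda>M\<in>maximal_chains P. label_sequence s M)"
  define T where "T = (\<lambda>f. \<lambda>M\<in>maximal_chains P. weave f 1 (Suc n) (chain_list P M))"
  have "g s = g t \<longleftrightarrow> (\<forall>M\<in>maximal_chains P. label_sequence s M = label_sequence t M)" for s t
    by (auto simp: g_def fun_eq_iff restrict_def)
  then have equiv: "shuffle_equiv P n = {(s, t). s \<in> S \<and> t \<in> S \<and> g s = g t}"
    by (auto simp: shuffle_equiv_def S_def)
  have "card (hom_Shuffle P n) = card (g ` S)"
    unfolding hom_Shuffle_def S_def[symmetric] equiv by (rule card_quotient_kernel)
  also have "g ` S = T ` weak_maps P (Suc n)"
  proof (intro equalityI subsetI)
    fix y assume "y \<in> g ` S"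
    then obtain s where s: "is_shuffle P n s" "y = g s" by (auto simp: S_def)
    obtain f where "f \<in> weak_maps P (Suc n)"
      "\<And>M. M \<in> maximal_chains P \<Longrightarrow> label_sequence s M = weave f 1 (Suc n) (chain_list P M)"
      using shuffle_weave[OF P(1) s(1)] by metis
    then have "f \<in> weak_maps P (Suc n)" "g s = T f" by (auto simp: g_def T_def)
    then show "y \<in> T ` weak_maps P (Suc n)" using s(2) by blast
  next
    fix y assume "y \<in> T ` weak_maps P (Suc n)"
    then obtain f where fy: "f \<in> weak_maps P (Suc n)" "y = T f" by blast
    interpret weak_map P f n using P fy(1) by unfold_locales
    obtain s where "is_shuffle P n s"
      "\<And>M. M \<in> maximal_chains P \<Longrightarrow> label_sequence s M = weave f 1 (Suc n) (chain_list P M)"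
      using ex_shuffle by metis
    then have "s \<in> S" "g s = T f" by (auto simp: S_def g_def T_def)
    then show "y \<in> g ` S" using fy(2) by (metis imageI)
  qed
  also have "card \<dots> = card (weak_maps P (Suc n))"
  proof (rule card_image, rule inj_onI)
    fix f h assume f: "f \<in> weak_maps P (Suc n)" and h: "h \<in> weak_maps P (Suc n)" and eq: "T f = T h"
    have "weave f 1 (Suc n) (chain_list P M) = weave h 1 (Suc n) (chain_list P M)"
      if "M \<in> maximal_chains P" for M
      using fun_cong[OF eq, of M] that unfolding T_def by simp
    then show "f = h" by (rule weave_inj[OF P(1) f h])
  qed
  finally show ?thesis .
qed

lemma shuffle_series_nth:
  assumes "finite_poset P" "Field P \<noteq> {}"
  shows "fps_nth (shuffle_series P) n = of_nat (card (weak_maps P (Suc n)))"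
  by (simp add: shuffle_series_def card_hom_Shuffle[OF assms])

lemma weak_order_series_eq_shuffle_series:
  assumes "finite_poset P" "Field P \<noteq> {}"
  shows "weak_order_series P = fps_X * shuffle_series P"
  by (rule fps_ext) (auto simp: weak_order_series_def shuffle_series_nth[OF assms])

section \<open>Shuffle series of sums\<close>

lemma shuffle_series_disjoint_sum:
  assumes "sp_poset P" "sp_poset Q" "Field P \<inter> Field Q = {}"
  shows "shuffle_series (disjoint_sum P Q) = hadamard (shuffle_series P) (shuffle_series Q)"
proof (rule fps_ext)
  fix n
  note sp = sp_poset_finite_poset[OF assms(1)] sp_poset_finite_poset[OF assms(2)]
    sp_poset_finite_poset[OF sp_poset.disjoint_sum[OF assms]]
  show "fps_nth (shuffle_series (disjoint_sum P Q)) n =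
      fps_nth (hadamard (shuffle_series P) (shuffle_series Q)) n"
    using sp by (simp add: hadamard_def shuffle_series_nth card_weak_maps_disjoint_sum[OF assms(3)])
qed

text \<open>Multiplication by \<open>1 - fps_X\<close> takes differences of consecutive
  coefficients, which count the maps on \<open>P\<close> by their largest value \<open>k\<close>.
  With \<open>k = Suc i\<close>, the sum over \<open>k\<close> becomes the Cauchy product with the
  series of \<open>Q\<close>.\<close>

lemma shuffle_series_ordinal_sum:
  assumes "sp_poset P" "sp_poset Q" "Field P \<inter> Field Q = {}"
  shows "shuffle_series (ordinal_sum P Q) = shuffle_oplus (shuffle_series P) (shuffle_series Q)"
proof (rule fps_ext)
  fix n
  note P = sp_poset_finite_poset[OF assms(1)] and Q = sp_poset_finite_poset[OF assms(2)]
  note PQ = sp_poset_finite_poset[OF sp_poset.ordinal_sum[OF assms]]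
  have fin: "finite (Field P)" "finite (Field Q)" using P Q finite_posetD(1) by blast+
  have coeff: "fps_nth (shuffle_series P * (1 - fps_X)) i =
      of_nat (card (weak_maps P (Suc i)) - card (weak_maps P i))" for i
  proof -
    have "card (weak_maps P i) \<le> card (weak_maps P (Suc i))"
      by (intro card_mono finite_weak_maps fin weak_maps_mono) simp
    \<comment> \<open>At \<open>i = 0\<close> there is no preceding coefficient; the formula
      persists because a nonempty poset has no map to the empty chain.\<close>
    moreover have "card (weak_maps P 0) = 0" using weak_maps_0 P by fastforce
    ultimately show ?thesis
      using P by (cases i) (simp_all add: right_diff_distrib shuffle_series_nth)
  qed
  have "card (weak_maps (ordinal_sum P Q) (Suc n)) =
      (\<Sum>k = Suc 0..Suc n. (card (weak_maps P k) - card (weak_maps P (k - 1))) * card (weak_maps Q (Suc (Suc n) - k)))"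
    using card_weak_maps_ordinal_sum[OF assms(3) fin] P by simp
  also have "\<dots> = (\<Sum>i = 0..n. (card (weak_maps P (Suc i)) - card (weak_maps P i)) * card (weak_maps Q (Suc (n - i))))"
    unfolding sum.atLeast_Suc_atMost_Suc_shift by (intro sum.cong) (auto simp: Suc_diff_le)
  finally show "fps_nth (shuffle_series (ordinal_sum P Q)) n =
      fps_nth (shuffle_oplus (shuffle_series P) (shuffle_series Q)) n"
    using PQ Q by (simp add: shuffle_oplus_def fps_mult_nth[of _ "shuffle_series Q"] coeff shuffle_series_nth)
qed

section \<open>Disjoint copies of series-parallel posets\<close>

lemma sp_poset_dir_image:
  assumes "sp_poset P" "inj e"
  shows "sp_poset (dir_image P e)"
  using assms(1)
proof induction
  case (point a)
  have "dir_image {(a, a)} e = {(e a, e a)}" by (auto simp: dir_image_def)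
  then show ?case by (simp add: sp_poset.point)
next
  case (disjoint_sum P Q)
  have "dir_image (disjoint_sum P Q) e = disjoint_sum (dir_image P e) (dir_image Q e)"
    by (auto simp: dir_image_def disjoint_sum_def)
  moreover have "Field (dir_image P e) \<inter> Field (dir_image Q e) = {}"
    unfolding dir_image_Field using disjoint_sum.hyps(3) assms(2) by (auto dest: injD)
  ultimately show ?case using disjoint_sum by (simp add: sp_poset.disjoint_sum)
next
  case (ordinal_sum P Q)
  have "dir_image (ordinal_sum P Q) e = ordinal_sum (dir_image P e) (dir_image Q e)"
    unfolding ordinal_sum_def dir_image_Field by (auto simp: dir_image_def)
  moreover have "Field (dir_image P e) \<inter> Field (dir_image Q e) = {}"
    unfolding dir_image_Field using ordinal_sum.hyps(3) assms(2) by (auto dest: injD)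
  ultimately show ?case using ordinal_sum by (simp add: sp_poset.ordinal_sum)
qed

lemma card_weak_maps_dir_image:
  assumes e: "inj_on e (Field P)"
  shows "card (weak_maps (dir_image P e) n) = card (weak_maps P n)"
proof (rule bij_betw_same_card, rule bij_betwI)
  let ?to = "\<lambda>f. \<lambda>x\<in>Field P. f (e x)" and ?from = "\<lambda>g. \<lambda>y\<in>e ` Field P. g (inv_into (Field P) e y)"
  show "?to \<in> weak_maps (dir_image P e) n \<rightarrow> weak_maps P n"
  proof
    fix f assume f: "f \<in> weak_maps (dir_image P e) n"
    have "(e x, e y) \<in> dir_image P e" if "(x, y) \<in> P" for x y using that by (auto simp: dir_image_def)
    then show "?to f \<in> weak_maps P n"
      using f by (auto simp: weak_maps_def dir_image_Field FieldI1 FieldI2 PiE_def)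
  qed
  show "?from \<in> weak_maps P n \<rightarrow> weak_maps (dir_image P e) n"
  proof
    fix g assume g: "g \<in> weak_maps P n"
    have "?from g a \<le> ?from g b" if "(a, b) \<in> dir_image P e" for a b
      using that by (rule dir_imageE) (use g e in \<open>simp add: weak_maps_def inv_into_f_f\<close>)
    moreover have "?from g \<in> e ` Field P \<rightarrow>\<^sub>E {1..n}"
    proof
      fix y assume y: "y \<in> e ` Field P"
      then show "?from g y \<in> {1..n}" using g inv_into_into[OF y] by (auto simp: weak_maps_def)
    qed simp
    ultimately show "?from g \<in> weak_maps (dir_image P e) n"
      unfolding weak_maps_def dir_image_Field by blast
  qed
  show "?from (?to f) = f" if "f \<in> weak_maps (dir_image P e) n" for f
  proof
    fix y
    show "?from (?to f) y = f y"
    proof (cases "y \<in> e ` Field P")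
      case True
      then show ?thesis by (simp add: f_inv_into_f inv_into_into)
    next
      case False
      then show ?thesis using that by (auto simp: weak_maps_def dir_image_Field PiE_def extensional_def)
    qed
  qed
  show "?to (?from g) = g" if "g \<in> weak_maps P n" for g
  proof
    fix x
    show "?to (?from g) x = g x"
      using that e by (cases "x \<in> Field P") (auto simp: weak_maps_def PiE_def extensional_def inv_into_f_f)
  qed
qed

lemma shuffle_series_dir_image:
  assumes P: "sp_poset P" and e: "inj e"
  shows "shuffle_series (dir_image P e) = shuffle_series P"
proof -
  have "inj_on e (Field P)" using e by (rule inj_on_subset) simp
  then show ?thesis
    using sp_poset_finite_poset[OF P] sp_poset_finite_poset[OF sp_poset_dir_image[OF P e]]
    by (intro fps_ext) (simp add: shuffle_series_nth card_weak_maps_dir_image)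
qed

text \<open>The series of a sum is available only for disjoint summands, whereas two given elements
  may come from overlapping posets.\<close>

lemma shuffle_series_set_disjointE:
  assumes "x \<in> shuffle_series_set" "y \<in> shuffle_series_set"
  obtains P Q :: "nat rel" where "sp_poset P" "sp_poset Q" "Field P \<inter> Field Q = {}"
    "x = shuffle_series P" "y = shuffle_series Q"
proof -
  obtain P Q :: "nat rel" where P: "sp_poset P" "x = shuffle_series P"
    and Q: "sp_poset Q" "y = shuffle_series Q"
    using assms by (auto simp: shuffle_series_set_def)
  \<comment> \<open>One copy is placed on the even numbers and the other on the odd ones.\<close>
  have inj: "inj (\<lambda>k::nat. 2 * k)" "inj (\<lambda>k::nat. Suc (2 * k))" by (auto intro: injI)
  have "Field (dir_image P (\<lambda>k. 2 * k)) \<inter> Field (dir_image Q (\<lambda>k. Suc (2 * k))) = {}"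
    unfolding dir_image_Field by (auto; presburger)
  then show ?thesis
    using that P Q inj by (metis sp_poset_dir_image shuffle_series_dir_image)
qed

section \<open>The two algebras and their isomorphism\<close>

lemma sp_algebra_shuffle_series: "sp_algebra shuffle_series_set hadamard shuffle_oplus"
proof
  fix x y assume xy: "x \<in> shuffle_series_set" "y \<in> shuffle_series_set"
  \<comment> \<open>Closure is the part of the axioms that refers to posets; commutativity and
    associativity are identities between arbitrary power series.\<close>
  obtain P Q :: "nat rel" where PQ: "sp_poset P" "sp_poset Q" "Field P \<inter> Field Q = {}"
    "x = shuffle_series P" "y = shuffle_series Q"
    using shuffle_series_set_disjointE[OF xy] by metis
  show "hadamard x y \<in> shuffle_series_set"
    unfolding PQ(4,5) shuffle_series_disjoint_sum[OF PQ(1-3), symmetric] shuffle_series_set_def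
    using sp_poset.disjoint_sum[OF PQ(1-3)] by blast
  show "shuffle_oplus x y \<in> shuffle_series_set"
    unfolding PQ(4,5) shuffle_series_ordinal_sum[OF PQ(1-3), symmetric] shuffle_series_set_def
    using sp_poset.ordinal_sum[OF PQ(1-3)] by blast
qed (simp_all add: hadamard_def shuffle_oplus_def mult_ac)

lemma weak_order_series_set_eq: "weak_order_series_set = (*) fps_X ` shuffle_series_set"
proof -
  have eq: "weak_order_series P = fps_X * shuffle_series P" if "sp_poset P" for P :: "nat rel"
    using weak_order_series_eq_shuffle_series sp_poset_finite_poset[OF that] by blast
  show ?thesis
  proof (intro equalityI subsetI)
    fix x assume "x \<in> weak_order_series_set"
    then obtain P :: "nat rel" where P: "sp_poset P" "x = weak_order_series P"
      by (auto simp: weak_order_series_set_def)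
    then have "shuffle_series P \<in> shuffle_series_set" by (auto simp: shuffle_series_set_def)
    then show "x \<in> (*) fps_X ` shuffle_series_set" unfolding P(2) eq[OF P(1)] by (rule imageI)
  next
    fix x assume "x \<in> (*) fps_X ` shuffle_series_set"
    then obtain P :: "nat rel" where P: "sp_poset P" "x = fps_X * shuffle_series P"
      by (auto simp: shuffle_series_set_def)
    then show "x \<in> weak_order_series_set"
      unfolding P(2) eq[OF P(1), symmetric] weak_order_series_set_def by blast
  qed
qed

lemma hadamard_X: "hadamard (fps_X * f) (fps_X * g) = (fps_X * hadamard f g :: rat fps)"
  by (rule fps_ext) (simp add: hadamard_def)

text \<open>The product contains \<open>fps_X\<close> twice; the exact division cancels one of the
  two factors and leaves the other.\<close>

lemma weak_order_oplus_X: "weak_order_oplus (fps_X * f) (fps_X * g) = fps_X * shuffle_oplus f g"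
proof -
  have eq: "fps_X * f * (1 - fps_X) * (fps_X * g) = fps_X * (fps_X * shuffle_oplus f g)"
    by (simp add: shuffle_oplus_def mult_ac)
  show ?thesis unfolding weak_order_oplus_def eq by (rule nonzero_mult_div_cancel_left) simp
qed

lemma sp_algebra_iso_shuffle_weak_order:
  "sp_algebra_iso shuffle_series_set hadamard shuffle_oplus
    weak_order_series_set hadamard weak_order_oplus ((*) fps_X)"
proof -
  interpret sp_algebra shuffle_series_set hadamard shuffle_oplus by (rule sp_algebra_shuffle_series)
  \<comment> \<open>Multiplication by \<open>fps_X\<close> commutes with both operations, so the
    axioms pass from the shuffle series to their images.\<close>
  have "sp_algebra weak_order_series_set hadamard weak_order_oplus"
    unfolding weak_order_series_set_eq
    by unfold_locales
      (auto simp: hadamard_X weak_order_oplus_X du_closed os_closed du_assoc os_assoc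
        intro: du_commute)
  moreover have "bij_betw ((*) fps_X) shuffle_series_set weak_order_series_set"
    unfolding weak_order_series_set_eq by (intro inj_on_imp_bij_betw inj_onI) simp
  ultimately show ?thesis
    using sp_algebra_shuffle_series by (simp add: sp_algebra_iso_def hadamard_X weak_order_oplus_X)
qed

lemma chain_poset_finite_poset:
  assumes "1 \<le> i"
  shows "finite_poset (chain_poset i)" "Field (chain_poset i) \<noteq> {}"
proof -
  have F: "Field (chain_poset i) = {1..i}" by (auto simp: chain_poset_def Field_def)
  have "finite (chain_poset i)"
    by (rule finite_subset[of _ "{1..i} \<times> {1..i}"]) (auto simp: chain_poset_def)
  then show "finite_poset (chain_poset i)"
    unfolding finite_poset_def partial_order_on_def preorder_on_def F
    by (auto simp: chain_poset_def refl_on_def trans_def antisym_def)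
  show "Field (chain_poset i) \<noteq> {}" using assms by (simp add: F)
qed

theorem theorem3p13:
  shows "(\<exists>\<phi>. sp_algebra_iso shuffle_series_set hadamard shuffle_oplus
                weak_order_series_set hadamard weak_order_oplus \<phi>) \<and>
    (\<forall>P :: 'a rel. sp_poset P \<longrightarrow>
      (let n = card (Field P) in
        weak_order_series P =
          (\<Sum>i = 1..n. of_int ((-1) ^ (n - i) * strict_coeff P i) * weak_order_series (chain_poset i)) \<longrightarrow>
        shuffle_series P =
          (\<Sum>i = 1..n. of_int ((-1) ^ (n - i) * strict_coeff P i) * shuffle_series (chain_poset i))))"
proof (intro conjI allI impI)
  show "\<exists>\<phi>. sp_algebra_iso shuffle_series_set hadamard shuffle_oplus
      weak_order_series_set hadamard weak_order_oplus \<phi>"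
    using sp_algebra_iso_shuffle_weak_order by blast
next
  fix P :: "'a rel"
  assume P: "sp_poset P"
  define n where "n = card (Field P)"
  define c :: "nat \<Rightarrow> rat fps" where "c i = of_int ((-1) ^ (n - i) * strict_coeff P i)" for i
  have "shuffle_series P = (\<Sum>i = 1..n. c i * shuffle_series (chain_poset i))"
    if "weak_order_series P = (\<Sum>i = 1..n. c i * weak_order_series (chain_poset i))"
  proof -
    have "fps_X * shuffle_series P = weak_order_series P"
      using weak_order_series_eq_shuffle_series sp_poset_finite_poset[OF P] by metis
    also have "\<dots> = (\<Sum>i = 1..n. fps_X * (c i * shuffle_series (chain_poset i)))"
      unfolding that
    proof (intro sum.cong refl)
      \<comment> \<open>The sum starts at \<open>1\<close>, so every chain in it is nonempty, as the
        comparison of the two series requires.\<close>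
      fix i assume "i \<in> {1..n}"
      then have "weak_order_series (chain_poset i) = fps_X * shuffle_series (chain_poset i)"
        by (intro weak_order_series_eq_shuffle_series chain_poset_finite_poset) simp_all
      then show "c i * weak_order_series (chain_poset i) = fps_X * (c i * shuffle_series (chain_poset i))"
        by (simp only: mult.left_commute)
    qed
    \<comment> \<open>Rational power series form an integral domain, so the common factor
      \<open>fps_X\<close> can be cancelled.\<close>
    finally show ?thesis by (simp flip: sum_distrib_left)
  qed
  then show "let n = card (Field P) in
        weak_order_series P =
          (\<Sum>i = 1..n. of_int ((-1) ^ (n - i) * strict_coeff P i) * weak_order_series (chain_poset i)) \<longrightarrow>
        shuffle_series P =
          (\<Sum>i = 1..n. of_int ((-1) ^ (n - i) * strict_coeff P i) * shuffle_series (chain_poset i))"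
    unfolding Let_def n_def[symmetric] c_def by blast
qed

end
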